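(* Let $G$ be a non-negative measure on $(0,\infty)$ with $\theta=G(0,\infty)\in(0,1)$, $U=\sum_{n\ge0}G^{*n}$, let $z\ge0$ be locally bounded on $[0,\infty)$, and let $Z(x)=\int_0^xz(x-y)\,U(dy)$ (the unique locally bounded solution of $Z(x)=z(x)+\int_0^xZ(x-y)G(dy)$, $x\ge0$). Put $g(x)=G(x,x+1]$ and $I=\int_0^\infty z(y)\,dy$. (i) If $G/\theta\in\mathcal S_{(0,T]}$ for every $T\in(0,\infty)$, $z$ is directly Riemann integrable, and $z(x)/g(x)\to0$, then $Z(x)\sim\frac{I}{(1-\theta)^2}g(x)$. (ii) If $G/\theta\in\mathcal S_{(0,T]}$ for every $T\in(0,\infty)$, $z$ is directly Riemann integrable, and $z(x)/g(x)\to c\in(0,\infty)$, then $Z(x)\sim\left(\frac{I}{(1-\theta)^2}+\frac{c}{1-\theta}\right)g(x)$. (iii) If $0<I<\infty$, the probability density $z(y)/I$ on $[0,\infty)$ is subexponential (i.e. the distribution with this density belongs to $\mathcal S_{ac}$), and $z(x)/g(x)\to\infty$, then $Z(x)\sim\frac{1}{1-\theta}z(x)$. All asymptotics are as $x\to\infty$.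
   Context: For $0<T\le\infty$, $\Delta=(0,T]$, $x+\Delta=(x,x+T]$. A distribution $F$ on $\mathbb R$ belongs to $\mathcal L_\Delta$ if $F(x+\Delta)>0$ for all large $x$ and $F(x+t+\Delta)/F(x+\Delta)\to1$ uniformly in $t\in[0,1]$ as $x\to\infty$. A distribution $F$ on $[0,\infty)$ with unbounded support belongs to $\mathcal S_\Delta$ if $F\in\mathcal L_\Delta$ and $(F*F)(x+\Delta)\sim2F(x+\Delta)$. A density $f$ (of a distribution $F$ on $[0,\infty)$, considered on $[\widehat x,\infty)$) is long-tailed if it is bounded there, eventually positive, and $f(x+t)\sim f(x)$ uniformly in $t\in[0,1]$; $F\in\mathcal S_{ac}$ (subexponential density) if $f$ is long-tailed and $2\int_0^{\widehat x}f(x-y)F(dy)+\int_{\widehat x}^{x-\widehat x}f(x-y)f(y)dy\sim2f(x)$. Direct Riemann integrability is in the usual sense of renewal theory. $a\sim b$ means $a/b\to1$. *)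

theory Defs
  imports "HOL-Probability.Probability"
begin

(* n-fold convolution power of a (finite, Borel) measure on the real line;
   the 0-th power is the Dirac measure at 0 *)
fun conv_pow :: "real measure \<Rightarrow> nat \<Rightarrow> real measure" where
  "conv_pow G 0 = return borel 0"
| "conv_pow G (Suc n) = convolution G (conv_pow G n)"

(* renewal measure U = sum_{n>=0} G^{*n} *)
definition renewal_measure :: "real measure \<Rightarrow> real measure" where
  "renewal_measure G = measure_of UNIV (sets borel) (\<lambda>A. \<Sum>n. emeasure (conv_pow G n) A)"

(* Z(x) = int_[0,x] z(x-y) U(dy) *)
definition renewal_sol :: "real measure \<Rightarrow> (real \<Rightarrow> real) \<Rightarrow> real \<Rightarrow> real" where
  "renewal_sol G z x =
     enn2real (\<integral>\<^sup>+ y. indicator {0..x} y * ennreal (z (x - y)) \<partial>renewal_measure G)"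

(* the class L_Delta, Delta = (0,T], T a finite positive real *)
definition long_tailed_Delta :: "real \<Rightarrow> real measure \<Rightarrow> bool" where
  "long_tailed_Delta T F \<longleftrightarrow>
     (\<forall>\<^sub>F x in at_top. measure F {x<..x+T} > 0) \<and>
     (\<forall>\<epsilon>>0. \<forall>\<^sub>F x in at_top. \<forall>t\<in>{0..1}.
        \<bar>measure F {x+t<..x+t+T} / measure F {x<..x+T} - 1\<bar> < \<epsilon>)"

(* the class S_Delta: distributions on [0,oo) with unbounded support *)
definition subexp_Delta :: "real \<Rightarrow> real measure \<Rightarrow> bool" where
  "subexp_Delta T F \<longleftrightarrow>
     prob_space F \<and> sets F = sets borel \<and> measure F {..<0} = 0 \<and>
     (\<forall>x. measure F {x<..} > 0) \<and>
     long_tailed_Delta T F \<and>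
     ((\<lambda>x. measure (convolution F F) {x<..x+T} / measure F {x<..x+T}) \<longlongrightarrow> 2) at_top"

(* subexponential density (class S_ac) of the distribution F(dy) = f(y) dy on [0,oo) *)
definition subexp_density :: "(real \<Rightarrow> real) \<Rightarrow> bool" where
  "subexp_density f \<longleftrightarrow>
     (\<exists>xh\<ge>0.
        (\<exists>B. \<forall>x\<ge>xh. \<bar>f x\<bar> \<le> B) \<and>
        (\<forall>\<^sub>F x in at_top. f x > 0) \<and>
        (\<forall>\<epsilon>>0. \<forall>\<^sub>F x in at_top. \<forall>t\<in>{0..1}. \<bar>f (x + t) / f x - 1\<bar> < \<epsilon>) \<and>
        (\<lambda>x. 2 * (LINT y:{0..xh}|lborel. f (x - y) * f y)
              + (LINT y:{xh..x-xh}|lborel. f (x - y) * f y))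
          \<sim>[at_top] (\<lambda>x. 2 * f x))"

(* direct Riemann integrability of z on [0,oo) *)
definition upper_dR :: "(real \<Rightarrow> real) \<Rightarrow> real \<Rightarrow> nat \<Rightarrow> real" where
  "upper_dR z h n = Sup (z ` {real n * h .. real (Suc n) * h})"

definition lower_dR :: "(real \<Rightarrow> real) \<Rightarrow> real \<Rightarrow> nat \<Rightarrow> real" where
  "lower_dR z h n = Inf (z ` {real n * h .. real (Suc n) * h})"

definition dRi :: "(real \<Rightarrow> real) \<Rightarrow> bool" where
  "dRi z \<longleftrightarrow>
     (\<forall>h>0. (\<forall>n. bdd_above (z ` {real n * h .. real (Suc n) * h})
                 \<and> bdd_below (z ` {real n * h .. real (Suc n) * h}))
           \<and> summable (upper_dR z h) \<and> summable (lower_dR z h)) \<and>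
     ((\<lambda>h. h * (\<Sum>n. upper_dR z h n) - h * (\<Sum>n. lower_dR z h n)) \<longlongrightarrow> 0) (at_right 0)"

definition locally_bounded :: "(real \<Rightarrow> real) \<Rightarrow> bool" where
  "locally_bounded z \<longleftrightarrow> (\<forall>a. \<exists>B. \<forall>x\<in>{0..a}. \<bar>z x\<bar> \<le> B)"

end

theory Submission
  imports Defs
begin

text \<open>
  The renewal equation is handled directly, without estimates on the convolution powers. Let \<open>h\<close>
  be \<open>x \<mapsto> G(x, x + T]\<close> or \<open>z\<close>. Subexponentiality says that only jumps close to \<open>0\<close> or to \<open>x\<close>
  contribute to convolutions on the scale \<open>h(x)\<close>. Hence
  \<open>Z(x) \<le> C h(x) + \<integral> Z(x - y) G(dy)\<close> over \<open>0 < y \<le> x - x0\<close>, while the same integral of \<open>h\<close> is at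
  most \<open>\<rho> h(x)\<close> with \<open>\<rho> < 1\<close>; taking the supremum of \<open>Z/h\<close> over \<open>[x0, X]\<close> on both sides gives a bound
  that does not depend on \<open>X\<close>. Once \<open>Z/h\<close> is bounded, the equation shows that an asymptotic bound
  \<open>M\<close> for \<open>\<bar>Z/h - L\<bar>\<close> improves to \<open>\<theta> M + \<epsilon>\<close>, so \<open>Z/h\<close> converges.

  This applies to \<open>h = z\<close> in part (iii), and with \<open>U(x, x + T]\<close> in the role of \<open>Z\<close> it yields
  \<open>U(x, x + T] \<sim> G(x, x + T] / (1 - \<theta>)\<^sup>2\<close>. For parts (i) and (ii) one splits \<open>\<integral> z(x - y) U(dy)\<close> at
  \<open>y = a\<close> and \<open>y = x - a\<close>: the first piece gives the term with \<open>c\<close>, the middle one is negligible, and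
  the last one is a Riemann sum of \<open>z\<close> over windows of length \<open>1/n\<close>.
\<close>

section \<open>Long-tailed functions\<close>

text \<open>The limits come from fixed-point equations. For windows of U, a first jump near 0
  reproduces the unknown ratio L with weight \<theta>, while a first jump near x is followed by a
  renewal mass of total 1 / (1 - \<theta>); hence L = \<theta> L + 1 / (1 - \<theta>). In part (iii)
  jumps near x cost only o(z(x)), and the balance is L = \<theta> L + 1. Such a balance proves
  nothing before Z/h is known to be bounded, and the supremum argument for that must start from a
  finite supremum. Since h need be neither continuous nor monotone, its lower bounds on compact
  intervals have to be extracted from long-tailedness, and x0 lies beyond the region where h may
  vanish. Jumps in (x - x0, x] leave a remainder below x0, where h gives no control; they are paid
  for by the term C h(x). A second obstacle is that G need not have a density, so in part (iii) it
  can be compared with \<open>z\<close> only after smearing over unit windows.\<close>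

definition long_tailed_fun :: "(real \<Rightarrow> real) \<Rightarrow> bool" where
  "long_tailed_fun h \<longleftrightarrow> (\<forall>\<^sub>F x in at_top. h x > 0) \<and>
     (\<forall>\<epsilon>>0. \<forall>\<^sub>F x in at_top. \<forall>t\<in>{0..1}. \<bar>h (x + t) / h x - 1\<bar> < \<epsilon>)"

lemma eventually_at_top_shift:
  fixes a :: real
  assumes "\<forall>\<^sub>F x in at_top. P x"
  shows "\<forall>\<^sub>F x in at_top. \<forall>y\<ge>x-a. P y"
proof -
  obtain N where N: "\<And>x. x \<ge> N \<Longrightarrow> P x"
    using assms unfolding eventually_at_top_linorder by blast
  then have "\<And>x. x \<ge> N + a \<Longrightarrow> \<forall>y\<ge>x-a. P y" by force
  then show ?thesis unfolding eventually_at_top_linorder by blast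
qed

text \<open>Convolution integrals need h(x - t) measured against h(x), whereas the definition
  measures by the value at the left point. Applying it at the base point x - t costs a factor
  2.\<close>

lemma long_tailed_fun_step:
  assumes "long_tailed_fun h" "0 < \<epsilon>"
  shows "\<forall>\<^sub>F x in at_top. \<forall>t\<in>{0..1}. \<bar>h (x - t) - h x\<bar> \<le> \<epsilon> * h x"
proof -
  \<comment> \<open>The bound 1/2 gives h(x - t) \<le> 2 h(x); the bound \<epsilon>/2 absorbs that
    factor 2.\<close>
  define d where "d = min (1/2) (\<epsilon>/2)"
  have d: "0 < d" "d \<le> 1/2" "2 * d \<le> \<epsilon>" using assms(2) by (auto simp: d_def)
  have "\<forall>\<^sub>F x in at_top. h x > 0 \<and> (\<forall>t\<in>{0..1}. \<bar>h (x + t) / h x - 1\<bar> < d)"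
    using assms(1) d(1) unfolding long_tailed_fun_def by (auto intro: eventually_conj)
  from eventually_at_top_shift[OF this, of 1] show ?thesis
  proof (rule eventually_mono, intro ballI)
    fix x t :: real
    assume *: "\<forall>y\<ge>x - 1. h y > 0 \<and> (\<forall>t\<in>{0..1}. \<bar>h (y + t) / h y - 1\<bar> < d)" and t: "t \<in> {0..1}"
    have p: "h (x - t) > 0" "h x > 0" using * t by auto
    have "x - 1 \<le> x - t" using t by simp
    with * t have "\<bar>h (x - t + t) / h (x - t) - 1\<bar> < d" by blast
    then have "\<bar>h x / h (x - t) - 1\<bar> < d" by simp
    also have "h x / h (x - t) - 1 = (h x - h (x - t)) / h (x - t)"
      using p by (simp add: field_simps)
    finally have 1: "\<bar>h x - h (x - t)\<bar> < d * h (x - t)" using p by (simp add: field_simps)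
    have "d * h (x - t) \<le> 1/2 * h (x - t)" using d p by (intro mult_right_mono) auto
    with 1 have 2: "h (x - t) \<le> 2 * h x" by (simp add: abs_if split: if_splits)
    have "d * h (x - t) \<le> d * (2 * h x)" using 2 d by (intro mult_left_mono) auto
    also have "\<dots> = (2 * d) * h x" by simp
    also have "\<dots> \<le> \<epsilon> * h x" using d p by (intro mult_right_mono) auto
    finally show "\<bar>h (x - t) - h x\<bar> \<le> \<epsilon> * h x" using 1 by (simp add: abs_if split: if_splits)
  qed
qed

text \<open>Long shifts are chained from unit shifts. Each further unit enlarges the error, so the
  induction has to be free to start from a smaller one.\<close>

lemma long_tailed_fun_uniform:
  assumes h: "long_tailed_fun h" and e: "0 < \<epsilon>"
  shows "\<forall>\<^sub>F x in at_top. \<forall>t\<in>{0..a}. \<bar>h (x - t) - h x\<bar> \<le> \<epsilon> * h x"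
proof -
  have *: "\<forall>\<^sub>F x in at_top. \<forall>t\<in>{0..real n}. \<bar>h (x - t) - h x\<bar> \<le> \<epsilon> * h x" if "0 < \<epsilon>" for n \<epsilon>
    using that
  proof (induction n arbitrary: \<epsilon>)
    case 0
    have "\<forall>\<^sub>F x in at_top. h x > 0" using h by (simp add: long_tailed_fun_def)
    then show ?case by eventually_elim (use 0 in auto)
  next
    case (Suc n)
    \<comment> \<open>The first n units cost d h(x), the last one d h(x - s) \<le> 2 d h(x).\<close>
    define d where "d = min 1 (\<epsilon>/3)"
    have d: "0 < d" "d \<le> 1" "3 * d \<le> \<epsilon>" using Suc.prems by (auto simp: d_def)
    have "\<forall>\<^sub>F x in at_top. h x > 0" using h by (simp add: long_tailed_fun_def)
    moreover note Suc.IH[OF d(1)]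
    moreover note eventually_at_top_shift[OF long_tailed_fun_step[OF h d(1)], of "real n"]
    ultimately show ?case
    proof (eventually_elim, intro ballI)
      fix x t :: real
      assume p: "h x > 0"
        and 1: "\<forall>t\<in>{0..real n}. \<bar>h (x - t) - h x\<bar> \<le> d * h x"
        and 2: "\<forall>y\<ge>x - real n. \<forall>t\<in>{0..1}. \<bar>h (y - t) - h y\<bar> \<le> d * h y"
        and t: "t \<in> {0..real (Suc n)}"
      define s where "s = min t (real n)"
      have s: "s \<in> {0..real n}" "t - s \<in> {0..1}" using t by (auto simp: s_def)
      have a: "\<bar>h (x - s) - h x\<bar> \<le> d * h x" using 1 s by blast
      have "\<bar>h ((x - s) - (t - s)) - h (x - s)\<bar> \<le> d * h (x - s)"
        using 2[rule_format, of "x - s" "t - s"] s by auto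
      moreover have "d * h x \<le> 1 * h x" using d p by (intro mult_right_mono) auto
      then have "h (x - s) \<le> 2 * h x" using a by (simp add: abs_if split: if_splits)
      then have "d * h (x - s) \<le> d * (2 * h x)" using d by (intro mult_left_mono) auto
      ultimately have "\<bar>h (x - t) - h x\<bar> \<le> 3 * d * h x" using a by simp
      also have "\<dots> \<le> \<epsilon> * h x" using d p by (intro mult_right_mono) auto
      finally show "\<bar>h (x - t) - h x\<bar> \<le> \<epsilon> * h x" .
    qed
  qed
  obtain n where "a \<le> real n" using real_arch_simple by blast
  with *[OF e, of n] show ?thesis by (auto elim!: eventually_mono)
qed

text \<open>Pointwise positivity gives no positive lower bound on a compact interval, as h may be
  discontinuous. But one unit step to the right at most halves h, so n steps from x0 leave at least
  h(x0) / 2^n.\<close>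

lemma long_tailed_fun_bounded_below:
  assumes h: "long_tailed_fun h"
  shows "\<forall>\<^sub>F x0 in at_top. \<forall>X. \<exists>\<delta>>0. \<forall>x\<in>{x0..X}. \<delta> \<le> h x"
proof -
  have "\<forall>\<^sub>F x in at_top. h x > 0" using h by (simp add: long_tailed_fun_def)
  moreover have "\<forall>\<^sub>F x in at_top. \<forall>t\<in>{0..1}. \<bar>h (x - t) - h x\<bar> \<le> 1 * h x"
    by (rule long_tailed_fun_step[OF h]) simp
  ultimately have "\<forall>\<^sub>F x in at_top. h x > 0 \<and> (\<forall>t\<in>{0..1}. \<bar>h (x - t) - h x\<bar> \<le> 1 * h x)"
    by (rule eventually_conj)
  from eventually_at_top_shift[OF this, of 0] show ?thesis
  proof (rule eventually_mono, intro allI)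
    fix x0 X :: real
    assume *: "\<forall>y\<ge>x0 - 0. h y > 0 \<and> (\<forall>t\<in>{0..1}. \<bar>h (y - t) - h y\<bar> \<le> 1 * h y)"
    have pos: "h y > 0" if "y \<ge> x0" for y using * that by auto
    have **: "h (y - t) \<le> 2 * h y" if "y \<ge> x0" "t \<in> {0..1}" for y t
      using * that by (force simp: abs_le_iff)
    have main: "\<forall>x\<in>{x0..x0 + real n}. h x0 / 2 ^ n \<le> h x" for n
    proof (induction n)
      case 0 then show ?case by simp
    next
      case (Suc n)
      show ?case
      proof
        fix x assume x: "x \<in> {x0..x0 + real (Suc n)}"
        define t where "t = min 1 (x - x0)"
        have "x - t \<in> {x0..x0 + real n}" "t \<in> {0..1}" using x by (auto simp: t_def)
        then have "h x0 / 2 ^ n \<le> 2 * h x" using Suc **[of x t] x by force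
        then show "h x0 / 2 ^ Suc n \<le> h x" by simp
      qed
    qed
    obtain n where "X - x0 \<le> real n" using real_arch_simple by blast
    then show "\<exists>\<delta>>0. \<forall>x\<in>{x0..X}. \<delta> \<le> h x"
      using main[of n] pos[of x0] by (intro exI[of _ "h x0 / 2 ^ n"]) auto
  qed
qed

section \<open>Abstract boundedness and convergence of ratios Z/h for renewal inequalities\<close>

lemma contraction_tendsto_0:
  fixes f :: "'a \<Rightarrow> real"
  assumes nonneg: "\<And>x. 0 \<le> f x" and bd: "\<forall>\<^sub>F x in F. f x \<le> M0"
    and \<theta>: "0 \<le> \<theta>" "\<theta> < 1"
    and step: "\<And>M \<epsilon>. 0 < \<epsilon> \<Longrightarrow> \<forall>\<^sub>F x in F. f x \<le> M \<Longrightarrow> \<forall>\<^sub>F x in F. f x \<le> \<theta> * M + \<epsilon>"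
  shows "(f \<longlongrightarrow> 0) F"
proof (rule tendstoI)
  fix e :: real assume e: "0 < e"
  have *: "\<forall>\<^sub>F x in F. f x \<le> \<theta> ^ n * M0 + e / 2" for n
  proof (induction n)
    case 0 show ?case using bd by eventually_elim (use e in auto)
  next
    case (Suc n)
    \<comment> \<open>The slack (1 - \<theta>) e/2 is the one for which e/2 is a fixed point of M
      \<mapsto> \<theta> M + slack.\<close>
    have "\<forall>\<^sub>F x in F. f x \<le> \<theta> * (\<theta> ^ n * M0 + e / 2) + (1 - \<theta>) * (e / 2)"
      by (rule step[OF _ Suc]) (use e \<theta> in auto)
    then show ?case by (rule eventually_mono) (simp add: field_simps)
  qed
  have "(\<lambda>n. \<theta> ^ n * M0) \<longlonglongrightarrow> 0 * M0" by (intro tendsto_intros LIMSEQ_power_zero) (use \<theta> in auto)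
  then have "\<forall>\<^sub>F n in sequentially. \<theta> ^ n * M0 < e / 2" using e by (intro order_tendstoD) auto
  then obtain n where n: "\<theta> ^ n * M0 < e / 2" by (auto simp: eventually_sequentially)
  from *[of n] show "\<forall>\<^sub>F x in F. dist (f x) 0 < e"
    by eventually_elim (use n nonneg in \<open>simp add: dist_real_def\<close>)
qed

lemma (in finite_measure) set_integrable_bounded:
  fixes f :: "'a \<Rightarrow> real"
  assumes "f \<in> borel_measurable M" "S \<in> sets M" "\<And>x. x \<in> S \<Longrightarrow> \<bar>f x\<bar> \<le> B"
  shows "set_integrable M S f"
  unfolding set_integrable_def
proof (rule integrable_const_bound[where B="max 0 B"])
  show "AE x in M. norm (indicat_real S x *\<^sub>R f x) \<le> max 0 B"
    using assms(3) by (intro AE_I2) (force simp: indicator_def)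
qed (use assms in measurable)

text \<open>Cutting the integral at y = x - x0 keeps x - y inside [x0, X], so the supremum S of Z/h
  over that interval dominates the integrand. This yields S \<le> max C1 (C + \<rho> S) with C1
  independent of X. The local bounds on Z and h serve to make S finite.\<close>

lemma bounded_ratio:
  fixes G :: "real measure" and Z h :: "real \<Rightarrow> real"
  assumes G: "finite_measure G" and sets: "sets G = sets borel"
    and Z: "Z \<in> borel_measurable borel" and h: "h \<in> borel_measurable borel"
    and Zbd: "\<And>X. \<exists>B. \<forall>x\<in>{x0..X}. \<bar>Z x\<bar> \<le> B"
    and hbd: "\<And>X. \<exists>B. \<forall>x\<in>{x0..X}. \<bar>h x\<bar> \<le> B"
    and hpos: "\<And>X. \<exists>\<delta>>0. \<forall>x\<in>{x0..X}. \<delta> \<le> h x"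
    and \<rho>: "\<rho> < 1"
    and hconv: "\<forall>\<^sub>F x in at_top. (LINT y:{0<..x-x0}|G. h (x - y)) \<le> \<rho> * h x"
    and Zconv: "\<forall>\<^sub>F x in at_top. Z x \<le> C * h x + (LINT y:{0<..x-x0}|G. Z (x - y))"
  shows "\<exists>K\<ge>0. \<forall>x\<ge>x0. Z x \<le> K * h x"
proof -
  interpret finite_measure G by fact
  have pos: "h x > 0" if "x \<ge> x0" for x
    using hpos[of x] that by force
  have int: "set_integrable G {0<..x-x0} (\<lambda>y. f (x - y))"
    if bdd: "\<exists>B. \<forall>x\<in>{x0..x}. \<bar>f x\<bar> \<le> B" and meas: "f \<in> borel_measurable borel" for f :: "real \<Rightarrow> real" and x
  proof -
    obtain B where B: "\<forall>x\<in>{x0..x}. \<bar>f x\<bar> \<le> B" using bdd by blast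
    have [measurable_cong]: "sets G = sets borel" by fact
    note meas[measurable]
    show ?thesis
      by (rule set_integrable_bounded[where B=B]) (use B in \<open>auto simp: sets\<close>)
  qed
  obtain x1 where x1: "x1 \<ge> x0"
    "\<And>x. x \<ge> x1 \<Longrightarrow> (LINT y:{0<..x-x0}|G. h (x - y)) \<le> \<rho> * h x"
    "\<And>x. x \<ge> x1 \<Longrightarrow> Z x \<le> C * h x + (LINT y:{0<..x-x0}|G. Z (x - y))"
  proof -
    from eventually_conj[OF hconv Zconv] obtain N where
      "\<forall>x\<ge>N. (LINT y:{0<..x-x0}|G. h (x - y)) \<le> \<rho> * h x \<and> Z x \<le> C * h x + (LINT y:{0<..x-x0}|G. Z (x - y))"
      unfolding eventually_at_top_linorder by blast
    then show ?thesis by (intro that[of "max N x0"]) auto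
  qed
  have bd: "\<exists>K\<ge>0. \<forall>x\<in>{x0..X}. Z x / h x \<le> K" for X
  proof -
    obtain B where B: "\<forall>x\<in>{x0..X}. \<bar>Z x\<bar> \<le> B" using Zbd by blast
    obtain \<delta> where d: "\<delta> > 0" "\<forall>x\<in>{x0..X}. \<delta> \<le> h x" using hpos by blast
    have "Z x / h x \<le> \<bar>B\<bar> / \<delta>" if "x \<in> {x0..X}" for x
      by (rule frac_le) (use B d that in force)+
    then show ?thesis using d by (intro exI[of _ "\<bar>B\<bar> / \<delta>"]) auto
  qed
  obtain C1 where C1: "C1 \<ge> 0" "\<forall>x\<in>{x0..x1}. Z x / h x \<le> C1" using bd by blast
  \<comment> \<open>C / (1 - \<rho>) solves S = C + \<rho> S; C1 covers the initial stretch, where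
    the inequalities are not yet available.\<close>
  define K where "K = max C1 (C / (1 - \<rho>))"
  have bound: "Z X / h X \<le> K" if X: "X \<ge> x0" for X
  proof -
    define S where "S = Sup ((\<lambda>x. Z x / h x) ` {x0..X})"
    have bddS: "bdd_above ((\<lambda>x. Z x / h x) ` {x0..X})"
      using bd[of X] unfolding bdd_above_def by blast
    have le: "Z x / h x \<le> S" if "x \<in> {x0..X}" for x
      unfolding S_def by (rule cSup_upper[OF _ bddS]) (use that in auto)
    have "S \<le> max C1 (C + \<rho> * S)" unfolding S_def
    proof (rule cSup_least)
      show "(\<lambda>x. Z x / h x) ` {x0..X} \<noteq> {}" using X by auto
    next
      fix q assume "q \<in> (\<lambda>x. Z x / h x) ` {x0..X}"
      then obtain x where x: "x \<in> {x0..X}" "q = Z x / h x" by blast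
      have "q \<le> max C1 (C + \<rho> * S)"
      proof (cases "x \<le> x1")
        case True
        then have "q \<le> C1" using C1 x by auto
        then show ?thesis by simp
      next
        case False
        then have x1x: "x \<ge> x1" by simp
        have "(LINT y:{0<..x-x0}|G. Z (x - y)) \<le> (LINT y:{0<..x-x0}|G. S * h (x - y))"
        proof (rule set_integral_mono)
          show "set_integrable G {0<..x - x0} (\<lambda>y. Z (x - y))" by (rule int[OF Zbd Z])
          show "set_integrable G {0<..x - x0} (\<lambda>y. S * h (x - y))"
            using int[OF hbd h] by simp
          fix y assume "y \<in> {0<..x - x0}"
          then have "x - y \<in> {x0..X}" using x by auto
          with le[OF this] pos[of "x-y"] show "Z (x - y) \<le> S * h (x - y)"
            by (simp add: field_simps)
        qed
        also have "\<dots> = S * (LINT y:{0<..x-x0}|G. h (x - y))" by simp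
        finally have a: "Z x \<le> C * h x + S * (LINT y:{0<..x-x0}|G. h (x - y))"
          using x1(3)[OF x1x] by linarith
        \<comment> \<open>A negative S cannot be multiplied into the upper bound
          \<open>\<rho> * h x\<close>, but then all ratios are at most 0 \<le> C1.\<close>
        show ?thesis
        proof (cases "S \<ge> 0")
          case True
          have "S * (LINT y:{0<..x-x0}|G. h (x - y)) \<le> S * (\<rho> * h x)"
            by (rule mult_left_mono[OF x1(2)[OF x1x] True])
          with a have "Z x \<le> (C + \<rho> * S) * h x" by (simp add: algebra_simps)
          then have "q \<le> C + \<rho> * S" using pos[of x] x by (simp add: pos_divide_le_eq)
          then show ?thesis by simp
        next
          case False
          then have "q \<le> 0" using le[of x] x by auto
          then show ?thesis using C1 by simp
        qed
      qed
      then show "q \<le> max C1 (C + \<rho> * Sup ((\<lambda>x. Z x / h x) ` {x0..X}))" by (simp add: S_def)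
    qed
    then have "S \<le> C1 \<or> (1 - \<rho>) * S \<le> C" by (auto simp: algebra_simps max_def split: if_splits)
    then have "S \<le> K" using \<rho> unfolding K_def by (auto simp: field_simps le_max_iff_disj)
    with le[of X] X show ?thesis by auto
  qed
  have "Z x \<le> K * h x" if "x \<ge> x0" for x
    using bound[OF that] pos[OF that] by (simp add: pos_divide_le_eq)
  moreover have "K \<ge> 0" using C1 by (simp add: K_def)
  ultimately show ?thesis by blast
qed

text \<open>L = c / (1 - \<theta>) solves L = c + \<theta> L. Substituting Z = L h + error into the
  equation multiplies an asymptotic error bound by \<theta>, up to \<epsilon>. The cutoff a makes
  the shift y bounded, so that h(x - y) may be replaced by h(x), while little mass of G is
  lost.\<close>

lemma ratio_limit:
  fixes G :: "real measure" and Z h :: "real \<Rightarrow> real"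
  assumes G: "finite_measure G" and sets: "sets G = sets borel"
    and \<theta>: "measure G {0<..} = \<theta>" "\<theta> < 1"
    and Z: "Z \<in> borel_measurable borel"
    and lt: "long_tailed_fun h"
    and Zbd: "\<forall>\<^sub>F x in at_top. \<bar>Z x\<bar> \<le> K * h x"
    and eqn: "\<And>\<epsilon>. 0 < \<epsilon> \<Longrightarrow> \<exists>a. measure G {a<..} \<le> \<epsilon> \<and> 0 \<le> a \<and>
        (\<forall>\<^sub>F x in at_top. \<bar>Z x - c * h x - (LINT y:{0<..a}|G. Z (x - y))\<bar> \<le> \<epsilon> * h x)"
  shows "((\<lambda>x. Z x / h x) \<longlongrightarrow> c / (1 - \<theta>)) at_top"
proof -
  interpret finite_measure G by fact
  have [measurable_cong]: "sets G = sets borel" by fact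
  note Z[measurable]
  define L where "L = c / (1 - \<theta>)"
  have L: "c + \<theta> * L = L" using \<theta> by (simp add: L_def field_simps)
  have \<theta>0: "0 \<le> \<theta>" using \<theta>(1) measure_nonneg[of G "{0<..}"] by simp
  have hpos: "\<forall>\<^sub>F x in at_top. h x > 0" using lt by (simp add: long_tailed_fun_def)
  have "((\<lambda>x. \<bar>Z x / h x - L\<bar>) \<longlongrightarrow> 0) at_top"
  proof (rule contraction_tendsto_0[where \<theta>=\<theta> and ?M0.0="K + \<bar>L\<bar>"])
    show "\<forall>\<^sub>F x in at_top. \<bar>Z x / h x - L\<bar> \<le> K + \<bar>L\<bar>"
      using hpos Zbd
    proof eventually_elim
      case (elim x)
      then have "\<bar>Z x / h x\<bar> \<le> K" by (simp add: field_simps)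
      then show ?case by linarith
    qed
  next
    fix M \<epsilon> :: real
    assume e: "0 < \<epsilon>" and M: "\<forall>\<^sub>F x in at_top. \<bar>Z x / h x - L\<bar> \<le> M"
    have M0: "M \<ge> 0"
    proof -
      obtain x where "\<bar>Z x / h x - L\<bar> \<le> M"
        using eventually_happens[OF M] by auto
      then show ?thesis by linarith
    qed
    \<comment> \<open>The denominator collects all errors: 1 for the equation, one \<bar>L\<bar> for
      the mass of G beyond a, and M + \<bar>L\<bar> for replacing h(x - y) by h(x).\<close>
    define d where "d = \<epsilon> / (1 + \<bar>L\<bar> + M + \<bar>L\<bar>)"
    have den: "1 + \<bar>L\<bar> + M + \<bar>L\<bar> > 0" using M0 by linarith
    then have d: "d > 0" "d * (1 + \<bar>L\<bar> + M + \<bar>L\<bar>) = \<epsilon>" using e by (auto simp: d_def)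
    obtain a where a: "0 \<le> a" "measure G {a<..} \<le> d"
      "\<forall>\<^sub>F x in at_top. \<bar>Z x - c * h x - (LINT y:{0<..a}|G. Z (x - y))\<bar> \<le> d * h x"
      using eqn[OF d(1)] by blast
    have m: "measure G {0<..a} = \<theta> - measure G {a<..}"
    proof -
      have *: "{0<..} = {0<..a} \<union> {a<..}" using a(1) by auto
      have "measure G {0<..} = measure G {0<..a} + measure G {a<..}"
        unfolding * by (rule finite_measure_Union) (auto simp: sets)
      then show ?thesis using \<theta> by simp
    qed
    from hpos a(3) long_tailed_fun_uniform[OF lt d(1), of a]
      eventually_at_top_shift[OF eventually_conj[OF hpos M], of a]
    show "\<forall>\<^sub>F x in at_top. \<bar>Z x / h x - L\<bar> \<le> \<theta> * M + \<epsilon>"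
    proof eventually_elim
      case (elim x)
      have near: "\<bar>Z (x - y) - L * h x\<bar> \<le> (M + M * d + \<bar>L\<bar> * d) * h x" if y: "y \<in> {0<..a}" for y
      proof -
        have p: "h (x - y) > 0" and q: "\<bar>Z (x - y) / h (x - y) - L\<bar> \<le> M" using elim(4) y by auto
        have "Z (x - y) / h (x - y) - L = (Z (x - y) - L * h (x - y)) / h (x - y)"
          using p by (simp add: field_simps)
        with q p have 1: "\<bar>Z (x - y) - L * h (x - y)\<bar> \<le> M * h (x - y)" by (simp add: field_simps)
        have 2: "\<bar>h (x - y) - h x\<bar> \<le> d * h x" using elim(3) y by auto
        then have "h (x - y) \<le> (1 + d) * h x" by (simp add: algebra_simps abs_le_iff)
        then have 3: "M * h (x - y) \<le> M * ((1 + d) * h x)" using M0 by (rule mult_left_mono)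
        have "\<bar>L * h (x - y) - L * h x\<bar> = \<bar>L\<bar> * \<bar>h (x - y) - h x\<bar>"
          by (simp add: abs_mult[symmetric] algebra_simps)
        also have "\<dots> \<le> \<bar>L\<bar> * (d * h x)" using 2 by (rule mult_left_mono) simp
        finally show ?thesis using 1 3 by (simp add: algebra_simps)
      qed
      define J where "J = (LINT y:{0<..a}|G. Z (x - y))"
      have ZB: "\<bar>Z (x - y)\<bar> \<le> (M + M * d + \<bar>L\<bar> * d) * h x + \<bar>L * h x\<bar>" if "y \<in> {0<..a}" for y
        using near[OF that] by linarith
      have Zint: "set_integrable G {0<..a} (\<lambda>y. Z (x - y))"
        by (rule set_integrable_bounded[OF _ _ ZB]) (auto simp: sets)
      have cint: "set_integrable G {0<..a} (\<lambda>y. k)" for k :: real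
        by (rule set_integrable_bounded[where B="\<bar>k\<bar>"]) (auto simp: sets)
      have const: "(LINT y:{0<..a}|G. k) = k * measure G {0<..a}" for k :: real
        by (subst set_integral_const) (auto simp: sets less_top[symmetric])
      let ?E = "(M + M * d + \<bar>L\<bar> * d) * h x"
      have "J \<le> (LINT y:{0<..a}|G. L * h x + ?E)" unfolding J_def
        by (rule set_integral_mono[OF Zint cint]) (use near in \<open>force simp: abs_le_iff\<close>)
      moreover have "(LINT y:{0<..a}|G. L * h x - ?E) \<le> J" unfolding J_def
        by (rule set_integral_mono[OF cint Zint]) (use near in \<open>force simp: abs_le_iff\<close>)
      ultimately have J: "\<bar>J - L * h x * measure G {0<..a}\<bar> \<le> ?E * measure G {0<..a}"
        unfolding const by (simp add: algebra_simps abs_le_iff)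
      have E0: "?E \<ge> 0" using M0 d elim(1) by (intro mult_nonneg_nonneg add_nonneg_nonneg) auto
      have "?E * measure G {0<..a} \<le> ?E * \<theta>" using m E0
        by (intro mult_left_mono) (simp_all add: measure_nonneg)
      moreover have "\<bar>L * h x * measure G {0<..a} - L * h x * \<theta>\<bar> \<le> \<bar>L\<bar> * h x * d"
      proof -
        have "\<bar>L * h x * measure G {0<..a} - L * h x * \<theta>\<bar> = \<bar>L\<bar> * h x * measure G {a<..}"
          using elim(1) unfolding m by (simp add: algebra_simps abs_mult)
        also have "\<dots> \<le> \<bar>L\<bar> * h x * d" using a(2) elim(1) by (intro mult_left_mono) auto
        finally show ?thesis .
      qed
      moreover have "\<bar>Z x - c * h x - J\<bar> \<le> d * h x" using elim(2) by (simp add: J_def)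
      ultimately have "\<bar>Z x - c * h x - L * h x * \<theta>\<bar> \<le> ?E * \<theta> + \<bar>L\<bar> * h x * d + d * h x"
        using J by linarith
      moreover have "c * h x + L * h x * \<theta> = L * h x" using arg_cong[OF L, of "\<lambda>u. u * h x"]
        by (simp add: algebra_simps)
      ultimately have 4: "\<bar>Z x - L * h x\<bar> \<le> ?E * \<theta> + \<bar>L\<bar> * h x * d + d * h x" by (simp add: algebra_simps)
      have "(M * d + \<bar>L\<bar> * d) * h x * \<theta> \<le> (M * d + \<bar>L\<bar> * d) * h x * 1"
        using \<theta> M0 d elim(1) by (intro mult_left_mono mult_nonneg_nonneg add_nonneg_nonneg) auto
      with 4 have "\<bar>Z x - L * h x\<bar> \<le> (\<theta> * M + d * (1 + \<bar>L\<bar> + M + \<bar>L\<bar>)) * h x"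
        by (simp add: algebra_simps)
      then have "\<bar>Z x - L * h x\<bar> \<le> (\<theta> * M + \<epsilon>) * h x" by (simp only: d(2))
      moreover have "Z x / h x - L = (Z x - L * h x) / h x" using elim(1) by (simp add: field_simps)
      ultimately show ?case using elim(1) by (simp add: field_simps)
    qed
  qed (use \<theta> \<theta>0 in auto)
  then have "((\<lambda>x. Z x / h x - L) \<longlongrightarrow> 0) at_top" by (rule tendsto_rabs_zero_cancel)
  then show ?thesis unfolding L_def by (rule LIM_zero_cancel)
qed

section \<open>Windows of product measures\<close>

text \<open>A window is a difference of two monotone functions of x when T is nonnegative, and empty
  otherwise.\<close>

lemma measurable_window [measurable]:
  fixes M :: "real measure"
  assumes "finite_measure M" "sets M = sets borel"
  shows "(\<lambda>x. measure M {x<..x+T}) \<in> borel_measurable borel"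
proof (cases "T \<ge> 0")
  case True
  interpret finite_measure M by fact
  have mono: "mono (\<lambda>x. measure M {..x})"
    by (rule monoI, rule finite_measure_mono) (auto simp: assms)
  then have "mono (\<lambda>x. measure M {..x+T})" by (auto simp: mono_def)
  note [measurable] = mono[THEN borel_measurable_mono] this[THEN borel_measurable_mono]
  have "measure M {x<..x+T} = measure M {..x+T} - measure M {..x}" for x
  proof -
    have "{..x+T} = {..x} \<union> {x<..x+T}" using True by auto
    moreover have "measure M ({..x} \<union> {x<..x+T}) = measure M {..x} + measure M {x<..x+T}"
      by (rule finite_measure_Union) (auto simp: assms)
    ultimately show ?thesis by simp
  qed
  then show ?thesis by simp
next
  case False
  then have "{x<..x+T} = {}" for x by auto
  then show ?thesis by simp
qed

lemma finite_measure_tail_small: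
  fixes M :: "real measure"
  assumes "finite_measure M" "sets M = sets borel" "0 < \<epsilon>"
  shows "\<exists>a0. \<forall>a\<ge>a0. measure M {a<..} \<le> \<epsilon>"
proof -
  interpret finite_measure M by fact
  have "(\<lambda>n. measure M {real n<..}) \<longlonglongrightarrow> measure M (\<Inter>n. {real n<..})"
    by (rule finite_Lim_measure_decseq) (auto simp: assms decseq_def)
  moreover have "(\<Inter>n. {real n<..}) = {}"
    using reals_Archimedean2 less_asym by (fastforce simp: set_eq_iff)
  ultimately have "(\<lambda>n. measure M {real n<..}) \<longlonglongrightarrow> 0" by simp
  then have "\<forall>\<^sub>F n in sequentially. measure M {real n<..} < \<epsilon>"
    using assms(3) by (rule order_tendstoD)
  then obtain n where n: "measure M {real n<..} < \<epsilon>" by (auto simp: eventually_sequentially)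
  have "measure M {a<..} \<le> \<epsilon>" if "a \<ge> real n" for a
  proof -
    have "measure M {a<..} \<le> measure M {real n<..}"
      by (rule finite_measure_mono) (use that in \<open>auto simp: assms\<close>)
    with n show ?thesis by simp
  qed
  then show ?thesis by blast
qed

text \<open>Windows of a convolution are diagonal strips x < y + w \<le> x + T in the plane. The
  pairs used are (G, G), (G, U) and the reverse (U, G).\<close>

locale finite_borel_pair =
  M: finite_measure M + N: finite_measure N for M N :: "real measure" +
  assumes sets_M: "sets M = sets borel" and sets_N: "sets N = sets borel"
begin

sublocale pair_sigma_finite M N ..

sublocale P: finite_measure "M \<Otimes>\<^sub>M N"
  by (rule finite_measure_pair_measure) unfold_locales

lemma sets_P [measurable_cong]: "sets (M \<Otimes>\<^sub>M N) = sets (borel \<Otimes>\<^sub>M borel)"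
  by (rule sets_pair_measure_cong[OF sets_M sets_N])

lemma set_in_P:
  assumes [measurable]: "Measurable.pred (borel \<Otimes>\<^sub>M borel) P"
  shows "{p. P p} \<in> sets (M \<Otimes>\<^sub>M N)"
proof -
  have "{p \<in> space (borel \<Otimes>\<^sub>M borel). P p} \<in> sets (borel \<Otimes>\<^sub>M borel)" by measurable
  then show ?thesis by (simp add: sets_P space_pair_measure)
qed

lemma strip_set [measurable]:
  assumes [measurable]: "S \<in> sets borel" "R \<in> sets borel"
  shows "{(y, w). y \<in> S \<and> w \<in> R \<and> x < y + w \<and> y + w \<le> x + T} \<in> sets (M \<Otimes>\<^sub>M N)"
  by (rule set_in_P) (simp add: case_prod_beta')

lemma window_integrable:
  assumes "S \<in> sets borel" "finite_measure K" "sets K = sets borel"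
  shows "set_integrable M S (\<lambda>y. measure K {x - y<..x - y + T})"
proof -
  interpret K: finite_measure K by fact
  note [measurable_cong] = sets_M
  have [measurable]: "(\<lambda>x. measure K {x<..x+T}) \<in> borel_measurable borel"
    by (rule measurable_window) fact+
  show ?thesis
  proof (rule M.set_integrable_bounded[where B="measure K (space K)"])
    show "(\<lambda>y. measure K {x - y<..x - y + T}) \<in> borel_measurable M"
      by (rule measurable_compose[of "\<lambda>y. x - y" M borel "\<lambda>z. measure K {z<..z + T}"]) simp_all
  qed (use assms in \<open>auto simp: sets_M K.bounded_measure\<close>)
qed

text \<open>Used in both directions: integrals of windows become measures of planar sets, so that
  most later estimates reduce to inclusions between sets.\<close>

lemma measure_strip_fst:
  assumes S: "S \<in> sets borel"
  shows "measure (M \<Otimes>\<^sub>M N) {(y, w). y \<in> S \<and> x < y + w \<and> y + w \<le> x + T}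
       = (LINT y:S|M. measure N {x - y<..x - y + T})"
proof -
  have "emeasure (M \<Otimes>\<^sub>M N) {(y, w). y \<in> S \<and> x < y + w \<and> y + w \<le> x + T}
     = (\<integral>\<^sup>+y. emeasure N (Pair y -` {(y, w). y \<in> S \<and> x < y + w \<and> y + w \<le> x + T}) \<partial>M)"
    by (rule N.emeasure_pair_measure_alt) (use strip_set[OF S, of UNIV] in simp)
  also have "\<dots> = (\<integral>\<^sup>+y. ennreal (indicator S y *\<^sub>R measure N {x - y<..x - y + T}) \<partial>M)"
  proof (rule nn_integral_cong)
    fix y
    have "Pair y -` {(y, w). y \<in> S \<and> x < y + w \<and> y + w \<le> x + T}
        = (if y \<in> S then {x - y<..x - y + T} else {})" by auto
    then show "emeasure N (Pair y -` {(y, w). y \<in> S \<and> x < y + w \<and> y + w \<le> x + T})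
       = ennreal (indicator S y *\<^sub>R measure N {x - y<..x - y + T})"
      by (simp add: N.emeasure_eq_measure)
  qed
  also have "\<dots> = ennreal (LINT y:S|M. measure N {x - y<..x - y + T})"
    unfolding set_lebesgue_integral_def
    by (rule nn_integral_eq_integral)
       (use window_integrable[OF S N.finite_measure_axioms sets_N] in \<open>auto simp: set_integrable_def\<close>)
  finally show ?thesis
    by (simp add: measure_def set_lebesgue_integral_def integral_nonneg)
qed

end

lemma finite_borel_pair_commute: "finite_borel_pair M N \<Longrightarrow> finite_borel_pair N M"
  by (simp add: finite_borel_pair_def finite_borel_pair_axioms_def)

context finite_borel_pair
begin

lemma measure_swap:
  assumes "{p. Q p} \<in> sets (M \<Otimes>\<^sub>M N)"
  shows "measure (N \<Otimes>\<^sub>M M) {(w, y). Q (y, w)} = measure (M \<Otimes>\<^sub>M N) {p. Q p}"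
proof -
  have eq: "M \<Otimes>\<^sub>M N = distr (N \<Otimes>\<^sub>M M) (M \<Otimes>\<^sub>M N) (\<lambda>(x, y). (y, x))"
    by (rule distr_pair_swap)
  have "measure (M \<Otimes>\<^sub>M N) {p. Q p} = measure (distr (N \<Otimes>\<^sub>M M) (M \<Otimes>\<^sub>M N) (\<lambda>(x, y). (y, x))) {p. Q p}"
    using eq by simp
  also have "\<dots> = measure (N \<Otimes>\<^sub>M M) ((\<lambda>(x, y). (y, x)) -` {p. Q p} \<inter> space (N \<Otimes>\<^sub>M M))"
    by (rule measure_distr[OF _ assms]) (rule measurable_pair_swap')
  also have "(\<lambda>(x, y). (y, x)) -` {p. Q p} \<inter> space (N \<Otimes>\<^sub>M M) = {(w, y). Q (y, w)}"
    using sets.sets_into_space[OF assms] by (auto simp: space_pair_measure)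
  finally show ?thesis by simp
qed

lemma measure_strip_snd:
  assumes S: "S \<in> sets borel"
  shows "measure (M \<Otimes>\<^sub>M N) {(y, w). w \<in> S \<and> x < y + w \<and> y + w \<le> x + T}
       = (LINT w:S|N. measure M {x - w<..x - w + T})"
proof -
  interpret R: finite_borel_pair N M
    by (rule finite_borel_pair_commute) (rule finite_borel_pair_axioms)
  have "measure (M \<Otimes>\<^sub>M N) {p. snd p \<in> S \<and> x < fst p + snd p \<and> fst p + snd p \<le> x + T}
     = measure (N \<Otimes>\<^sub>M M) {(w, y). w \<in> S \<and> x < w + y \<and> w + y \<le> x + T}"
    using measure_swap[of "\<lambda>p. snd p \<in> S \<and> x < fst p + snd p \<and> fst p + snd p \<le> x + T"] strip_set[OF _ S, of UNIV x T]
    by (simp add: case_prod_beta' add.commute)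
  then show ?thesis using R.measure_strip_fst[OF S] by (simp add: case_prod_beta')
qed

lemma measure_convolution_window:
  "measure (convolution M N) {x<..x+T} = measure (M \<Otimes>\<^sub>M N) {(y, w). x < y + w \<and> y + w \<le> x + T}"
  unfolding convolution_def
  by (subst measure_distr)
     (auto simp: space_pair_measure sets_M[THEN sets_eq_imp_space_eq] sets_N[THEN sets_eq_imp_space_eq]
      sets_P cong: measurable_cong_sets intro!: arg_cong[where f="measure (M \<Otimes>\<^sub>M N)"])

text \<open>Subexponentiality says that this mass is \<open>o(G(x, x + T])\<close> as \<open>a \<rightarrow> \<infinity>\<close> after \<open>x \<rightarrow> \<infinity>\<close>, for \<open>M = N = G\<close>.\<close>

definition far :: "real \<Rightarrow> real \<Rightarrow> real \<Rightarrow> real" where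
  "far a T x = measure (M \<Otimes>\<^sub>M N) {(y, w). a < y \<and> a < w \<and> x < y + w \<and> y + w \<le> x + T}"

text \<open>If y \<le> a and w \<le> a, then y + w \<le> 2 a \<le> x; so the two strips near the
  axes are disjoint.\<close>

lemma far_decomp:
  assumes "2 * a \<le> x"
  shows "measure (convolution M N) {x<..x+T} = (LINT y:{..a}|M. measure N {x - y<..x - y + T})
     + (LINT w:{..a}|N. measure M {x - w<..x - w + T}) + far a T x"
proof -
  let ?Q = "\<lambda>y w. x < y + w \<and> y + w \<le> x + T"
  let ?A = "{(y, w). y \<in> {..a} \<and> ?Q y w}" and ?B = "{(y, w). w \<in> {..a} \<and> ?Q y w}"
    and ?C = "{(y, w). a < y \<and> a < w \<and> ?Q y w}"
  have s: "?A \<in> sets (M \<Otimes>\<^sub>M N)" "?B \<in> sets (M \<Otimes>\<^sub>M N)" "?C \<in> sets (M \<Otimes>\<^sub>M N)"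
    using strip_set[of "{..a}" UNIV x T] strip_set[of UNIV "{..a}" x T] strip_set[of "{a<..}" "{a<..}" x T]
    by simp_all
  have "{(y, w). ?Q y w} = (?A \<union> ?B) \<union> ?C" by auto
  moreover have "measure (M \<Otimes>\<^sub>M N) ((?A \<union> ?B) \<union> ?C) = measure (M \<Otimes>\<^sub>M N) (?A \<union> ?B) + measure (M \<Otimes>\<^sub>M N) ?C"
    by (rule P.finite_measure_Union) (use s in auto)
  moreover have "measure (M \<Otimes>\<^sub>M N) (?A \<union> ?B) = measure (M \<Otimes>\<^sub>M N) ?A + measure (M \<Otimes>\<^sub>M N) ?B"
    by (rule P.finite_measure_Union) (use s assms in auto)
  ultimately show ?thesis
    unfolding measure_convolution_window far_def
    using measure_strip_fst[of "{..a}" x T] measure_strip_snd[of "{..a}" x T] by simp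
qed

lemma far_antimono: "a \<le> b \<Longrightarrow> far b T x \<le> far a T x"
  unfolding far_def
  by (rule P.finite_measure_mono) (use strip_set[of "{a<..}" "{a<..}" x T] in auto)

lemma far_nonneg: "0 \<le> far a T x" by (simp add: far_def)

end

section \<open>The renewal measure\<close>

locale defective_renewal =
  fixes G :: "real measure" and \<theta> :: real
  assumes sets_G: "sets G = sets borel"
    and null_G: "emeasure G {..0} = 0"
    and mass_G: "emeasure G UNIV = ennreal \<theta>"
    and \<theta>_pos: "0 < \<theta>" and \<theta>_less_1: "\<theta> < 1"
begin

lemma space_G: "space G = UNIV"
  using sets_eq_imp_space_eq[OF sets_G] by simp

lemma finite_measure_G: "finite_measure G"
  by (rule finite_measureI) (simp add: space_G mass_G)

sublocale G: finite_measure G by (rule finite_measure_G)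

lemma AE_G_pos: "AE y in G. 0 < y"
  by (rule AE_I[where N="{..0}"]) (auto simp: null_G sets_G)

lemma measure_G_pos: "measure G {0<..} = \<theta>"
proof -
  have "emeasure G {0<..} = emeasure G UNIV"
    by (rule emeasure_eq_AE) (use AE_G_pos in \<open>auto simp: sets_G\<close>)
  then show ?thesis using \<theta>_pos by (simp add: measure_def mass_G)
qed

lemma sets_conv_pow [simp]: "sets (conv_pow G n) = sets borel"
  by (cases n) simp_all

lemma space_conv_pow [simp]: "space (conv_pow G n) = UNIV"
  by (cases n) simp_all

lemma finite_conv_pow: "finite_measure (conv_pow G n)"
proof (induction n)
  case 0
  then show ?case by (simp add: prob_space.finite_measure prob_space_return)
next
  case (Suc n)
  then show ?case by (simp add: convolution_finite finite_measure_G sets_G)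
qed

lemma emeasure_conv_pow_Suc:
  assumes [measurable]: "A \<in> sets borel"
  shows "emeasure (conv_pow G (Suc n)) A = (\<integral>\<^sup>+x. emeasure (conv_pow G n) {a. a + x \<in> A} \<partial>G)"
  using convolution_emeasure[OF assms finite_measure_G finite_conv_pow sets_conv_pow sets_G]
  by (simp add: space_G)

lemma emeasure_conv_pow_UNIV: "emeasure (conv_pow G n) UNIV = ennreal \<theta> ^ n"
proof (induction n)
  case 0 show ?case by (simp add: emeasure_return)
next
  case (Suc n)
  then show ?case
    using emeasure_conv_pow_Suc[of UNIV n] by (simp add: space_G mass_G mult.commute)
qed

lemma conv_pow_neg: "emeasure (conv_pow G n) {..<0} = 0"
proof (induction n)
  case 0 show ?case by (simp add: emeasure_return)
next
  case (Suc n)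
  have "emeasure (conv_pow G (Suc n)) {..<0} = (\<integral>\<^sup>+x. emeasure (conv_pow G n) {a. a + x \<in> {..<0}} \<partial>G)"
    by (rule emeasure_conv_pow_Suc) simp
  also have "\<dots> = (\<integral>\<^sup>+x. 0 \<partial>G)"
  proof (rule nn_integral_cong_AE, use AE_G_pos in eventually_elim)
    fix x :: real assume "0 < x"
    then have "emeasure (conv_pow G n) {a. a + x \<in> {..<0}} \<le> emeasure (conv_pow G n) {..<0}"
      by (intro emeasure_mono) auto
    then show "emeasure (conv_pow G n) {a. a + x \<in> {..<0}} = 0" using Suc by simp
  qed
  finally show ?case by simp
qed

abbreviation "U \<equiv> renewal_measure G"

lemma sets_U [simp, measurable_cong]: "sets U = sets borel"
  unfolding renewal_measure_def by (metis sets.sets_measure_of_eq sets_measure_of space_borel sets.space_closed)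

lemma space_U [simp]: "space U = UNIV"
  using sets_eq_imp_space_eq[OF sets_U] by simp

lemma emeasure_U:
  assumes "A \<in> sets borel"
  shows "emeasure U A = (\<Sum>n. emeasure (conv_pow G n) A)"
  unfolding renewal_measure_def
proof (rule emeasure_measure_of_sigma)
  show "sigma_algebra UNIV (sets borel :: real set set)"
    by (metis sets.sigma_algebra_axioms space_borel)
  show "positive (sets borel) (\<lambda>A. \<Sum>n. emeasure (conv_pow G n) A)"
    by (simp add: positive_def)
  show "countably_additive (sets borel) (\<lambda>A. \<Sum>n. emeasure (conv_pow G n) A)"
  proof (rule countably_additiveI)
    fix B :: "nat \<Rightarrow> real set"
    assume B: "range B \<subseteq> sets borel" "disjoint_family B"
    \<comment> \<open>A double series of nonnegative terms is exchanged by reading one sum as an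
      integral over the counting measure.\<close>
    have "(\<Sum>i. \<Sum>n. emeasure (conv_pow G n) (B i)) = (\<Sum>n. \<Sum>i. emeasure (conv_pow G n) (B i))"
      using nn_integral_suminf[of "\<lambda>n i. emeasure (conv_pow G n) (B i)" "count_space UNIV"]
      by (simp add: nn_integral_count_space_nat)
    also have "\<dots> = (\<Sum>n. emeasure (conv_pow G n) (\<Union>i. B i))"
      by (intro suminf_cong suminf_emeasure) (use B in auto)
    finally show "(\<Sum>i. \<Sum>n. emeasure (conv_pow G n) (B i)) = (\<Sum>n. emeasure (conv_pow G n) (\<Union>i. B i))" .
  qed
qed fact

lemma emeasure_U_UNIV: "emeasure U UNIV = ennreal (1 / (1 - \<theta>))"
proof -
  have "emeasure U UNIV = (\<Sum>n. ennreal (\<theta> ^ n))"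
    using \<theta>_pos by (simp add: emeasure_U emeasure_conv_pow_UNIV ennreal_power)
  also have "\<dots> = ennreal (\<Sum>n. \<theta> ^ n)"
    using \<theta>_pos \<theta>_less_1 by (intro suminf_ennreal2) (auto intro: summable_geometric)
  finally show ?thesis using \<theta>_pos \<theta>_less_1 by (simp add: suminf_geometric)
qed

lemma finite_measure_U: "finite_measure U"
  by (rule finite_measureI) (simp add: emeasure_U_UNIV)

sublocale U: finite_measure U by (rule finite_measure_U)

lemma measure_U_UNIV: "measure U UNIV = 1 / (1 - \<theta>)"
  using \<theta>_less_1 by (simp add: measure_def emeasure_U_UNIV)

lemma AE_U_nonneg: "AE y in U. 0 \<le> y"
  by (rule AE_I[where N="{..<0}"]) (auto simp: emeasure_U conv_pow_neg)

sublocale GU: finite_borel_pair G U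
  by unfold_locales (simp_all add: sets_G)

sublocale GG: finite_borel_pair G G
  by unfold_locales (simp_all add: sets_G)

text \<open>Splitting off the term n = 0 of the series leaves the convolution of G with the whole
  series. All renewal equations below derive from this identity.\<close>

lemma U_eq:
  assumes A [measurable]: "A \<in> sets borel"
  shows "emeasure U A = indicator A 0 + emeasure (convolution G U) A"
proof -
  have "emeasure U A = emeasure (conv_pow G 0) A + (\<Sum>n. emeasure (conv_pow G (Suc n)) A)"
    unfolding emeasure_U[OF A] using suminf_offset[of "\<lambda>n. emeasure (conv_pow G n) A" 1]
    by (simp add: summableI)
  also have "emeasure (conv_pow G 0) A = indicator A 0"
    using A by (simp add: emeasure_return)
  also have "(\<Sum>n. emeasure (conv_pow G (Suc n)) A)
       = (\<Sum>n. \<integral>\<^sup>+x. emeasure (conv_pow G n) {a. a + x \<in> A} \<partial>G)"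
    by (simp only: emeasure_conv_pow_Suc[OF A])
  also have "\<dots> = (\<integral>\<^sup>+x. (\<Sum>n. emeasure (conv_pow G n) {a. a + x \<in> A}) \<partial>G)"
  proof (rule nn_integral_suminf[symmetric])
    fix n
    interpret c: finite_measure "conv_pow G n" by (rule finite_conv_pow)
    have "{(x, a). a + x \<in> A} \<in> sets (G \<Otimes>\<^sub>M conv_pow G n)"
    proof -
      have "{p \<in> space (borel \<Otimes>\<^sub>M borel). snd p + fst p \<in> A} \<in> sets (borel \<Otimes>\<^sub>M borel :: (real \<times> real) measure)"
        by measurable
      then show ?thesis
        unfolding sets_pair_measure_cong[OF sets_G sets_conv_pow]
        by (simp add: space_pair_measure case_prod_beta')
    qed
    from c.measurable_emeasure_Pair[OF this]
    show "(\<lambda>x. emeasure (conv_pow G n) {a. a + x \<in> A}) \<in> borel_measurable G"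
      by (simp add: vimage_def)
  qed
  also have "\<dots> = (\<integral>\<^sup>+x. emeasure U {a. a + x \<in> A} \<partial>G)"
  proof (rule nn_integral_cong)
    fix x
    have "{a. a + x \<in> A} \<in> sets borel"
    proof -
      have "{a \<in> space borel. a + x \<in> A} \<in> sets borel" by measurable
      then show ?thesis by simp
    qed
    then show "(\<Sum>n. emeasure (conv_pow G n) {a. a + x \<in> A}) = emeasure U {a. a + x \<in> A}"
      by (rule emeasure_U[symmetric])
  qed
  also have "\<dots> = emeasure (convolution G U) A"
    using convolution_emeasure[OF A finite_measure_G finite_measure_U sets_U sets_G]
    by (simp add: space_G)
  finally show ?thesis .
qed

text \<open>Extends \<open>U_eq\<close> from indicators to nonnegative functions by monotone class
  induction; the renewal equation for \<open>Z\<close> is the case of a reflected and truncated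
  \<open>z\<close>.\<close>

lemma nn_integral_U_eq:
  assumes f: "f \<in> borel_measurable borel"
  shows "(\<integral>\<^sup>+x. f x \<partial>U) = f 0 + (\<integral>\<^sup>+y. \<integral>\<^sup>+w. f (y + w) \<partial>U \<partial>G)"
proof -
  have "(\<integral>\<^sup>+x. f x \<partial>U) = f 0 + (\<integral>\<^sup>+x. f x \<partial>convolution G U)"
    using f
  proof (induction rule: borel_measurable_induct)
    case (cong f g)
    then have "f = g" by auto
    with cong show ?case by simp
  next
    case (set A) then show ?case by (simp add: U_eq)
  next
    case (mult u c) then show ?case by (simp add: nn_integral_cmult distrib_left)
  next
    case (add u v) then show ?case by (simp add: nn_integral_add ac_simps)
  next
    case (seq F)
    have F: "incseq F" "\<And>i. F i \<in> borel_measurable borel" by fact+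
    have i: "incseq (\<lambda>i. nn_integral (convolution G U) (F i))"
      using F by (auto simp: incseq_def le_fun_def intro!: nn_integral_mono)
    have j: "incseq (\<lambda>i. F i 0)" using F by (auto simp: incseq_def le_fun_def)
    have "(\<integral>\<^sup>+x. (SUP i. F i x) \<partial>U) = (SUP i. nn_integral U (F i))"
      by (rule nn_integral_monotone_convergence_SUP[OF F(1)]) (use F in simp)
    also have "\<dots> = (SUP i. F i 0 + nn_integral (convolution G U) (F i))" using seq by simp
    also have "\<dots> = (SUP i. F i 0) + (SUP i. nn_integral (convolution G U) (F i))"
      by (rule ennreal_SUP_add[OF j i])
    also have "(SUP i. nn_integral (convolution G U) (F i)) = (\<integral>\<^sup>+x. (SUP i. F i x) \<partial>convolution G U)"
      by (rule nn_integral_monotone_convergence_SUP[OF F(1), symmetric]) (use F in simp)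
    finally show ?case by (simp only: SUP_apply)
  qed
  also have "(\<integral>\<^sup>+x. f x \<partial>convolution G U) = (\<integral>\<^sup>+y. \<integral>\<^sup>+w. f (y + w) \<partial>U \<partial>G)"
    by (rule nn_integral_convolution) (simp_all add: finite_measure_G finite_measure_U sets_G f)
  finally show ?thesis .
qed

text \<open>The unit atom of the zeroth power sits at 0, and the left-open window misses it as soon
  as x \<ge> 0.\<close>

lemma measure_U_window:
  assumes "0 \<le> x"
  shows "measure U {x<..x+T} = measure (convolution G U) {x<..x+T}"
proof -
  have "emeasure U {x<..x+T} = emeasure (convolution G U) {x<..x+T}"
    using U_eq[of "{x<..x+T}"] assms by simp
  then show ?thesis by (simp add: measure_def)
qed

end

section \<open>Local asymptotics of the renewal measure\<close>

text \<open>For bounded y both replacements f(x - y) by c h(x - y) and h(x - y) by h(x) are uniform.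
  This evaluates every piece of a convolution in which one jump stays bounded.\<close>

lemma set_integral_near:
  fixes M :: "real measure" and f h :: "real \<Rightarrow> real"
  assumes "finite_measure M" and sets: "sets M = sets borel"
    and f: "f \<in> borel_measurable borel" and lt: "long_tailed_fun h"
    and lim: "((\<lambda>x. f x / h x) \<longlongrightarrow> c) at_top"
    and S: "S \<in> sets borel" "S \<subseteq> {0..a}" and e: "0 < \<epsilon>"
  shows "\<forall>\<^sub>F x in at_top. \<bar>(LINT y:S|M. f (x - y)) - c * h x * measure M S\<bar> \<le> \<epsilon> * h x"
proof -
  interpret finite_measure M by fact
  note [measurable_cong] = sets
  note f[measurable]
  define m where "m = measure M S"
  have m: "m \<ge> 0" by (simp add: m_def)
  \<comment> \<open>Per unit of mass the error is 2 d from f and \<bar>c\<bar> d from h; m + 1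
    instead of m allows S to have mass 0.\<close>
  define d where "d = min 1 (\<epsilon> / ((2 + \<bar>c\<bar>) * (m + 1)))"
  have den: "(2 + \<bar>c\<bar>) * (m + 1) > 0" using m by (intro mult_pos_pos) auto
  have d: "0 < d" "d \<le> 1" using e den by (auto simp: d_def)
  have dm: "d * (2 + \<bar>c\<bar>) * m \<le> \<epsilon>"
  proof -
    have "d \<le> \<epsilon> / ((2 + \<bar>c\<bar>) * (m + 1))" by (simp add: d_def)
    then have "d * ((2 + \<bar>c\<bar>) * (m + 1)) \<le> \<epsilon>" by (simp add: pos_le_divide_eq[OF den])
    moreover have "d * (2 + \<bar>c\<bar>) * m \<le> d * (2 + \<bar>c\<bar>) * (m + 1)" using d by (intro mult_left_mono) auto
    ultimately show ?thesis by (simp add: mult.assoc)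
  qed
  have hpos: "\<forall>\<^sub>F x in at_top. h x > 0" using lt by (simp add: long_tailed_fun_def)
  have "\<forall>\<^sub>F x in at_top. dist (f x / h x) c < d" using lim d by (simp add: tendsto_iff)
  then have ev: "\<forall>\<^sub>F x in at_top. h x > 0 \<and> dist (f x / h x) c < d" using hpos by (simp add: eventually_conj)
  from hpos long_tailed_fun_uniform[OF lt d(1), of a] eventually_at_top_shift[OF ev, of a]
  show ?thesis
  proof eventually_elim
    case (elim x)
    let ?E = "d * (2 + \<bar>c\<bar>) * h x"
    have near: "\<bar>f (x - y) - c * h x\<bar> \<le> ?E" if y: "y \<in> S" for y
    proof -
      have p: "h (x - y) > 0" and q: "\<bar>f (x - y) / h (x - y) - c\<bar> < d" using elim(3) y S by (auto simp: dist_real_def)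
      have "f (x - y) / h (x - y) - c = (f (x - y) - c * h (x - y)) / h (x - y)" using p by (simp add: field_simps)
      with q p have 1: "\<bar>f (x - y) - c * h (x - y)\<bar> \<le> d * h (x - y)" by (simp add: field_simps)
      have 2: "\<bar>h (x - y) - h x\<bar> \<le> d * h x" using elim(2) y S by auto
      have "d * h x \<le> 1 * h x" using d elim(1) by (intro mult_right_mono) auto
      then have "h (x - y) \<le> 2 * h x" using 2 by (simp add: abs_le_iff)
      then have 3: "d * h (x - y) \<le> d * (2 * h x)" using d by (intro mult_left_mono) auto
      have "\<bar>c * h (x - y) - c * h x\<bar> = \<bar>c\<bar> * \<bar>h (x - y) - h x\<bar>" by (simp add: abs_mult[symmetric] algebra_simps)
      also have "\<dots> \<le> \<bar>c\<bar> * (d * h x)" using 2 by (rule mult_left_mono) simp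
      finally show ?thesis using 1 3 by (simp add: algebra_simps)
    qed
    have Zint: "set_integrable M S (\<lambda>y. f (x - y))"
    proof (rule set_integrable_bounded)
      show "\<bar>f (x - y)\<bar> \<le> ?E + \<bar>c * h x\<bar>" if "y \<in> S" for y using near[OF that] by linarith
    qed (use S in \<open>auto simp: sets\<close>)
    have cint: "set_integrable M S (\<lambda>y. k)" for k :: real
      by (rule set_integrable_bounded[where B="\<bar>k\<bar>"]) (use S in \<open>auto simp: sets\<close>)
    have const: "(LINT y:S|M. k) = k * m" for k :: real
      unfolding m_def by (subst set_integral_const) (use S in \<open>auto simp: sets less_top[symmetric]\<close>)
    have "(LINT y:S|M. f (x - y)) \<le> (LINT y:S|M. c * h x + ?E)"
      by (rule set_integral_mono[OF Zint cint]) (use near in \<open>force simp: abs_le_iff\<close>)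
    moreover have "(LINT y:S|M. c * h x - ?E) \<le> (LINT y:S|M. f (x - y))"
      by (rule set_integral_mono[OF cint Zint]) (use near in \<open>force simp: abs_le_iff\<close>)
    ultimately have "\<bar>(LINT y:S|M. f (x - y)) - c * h x * m\<bar> \<le> ?E * m"
      unfolding const by (simp add: algebra_simps abs_le_iff)
    also have "?E * m = (d * (2 + \<bar>c\<bar>) * m) * h x" by simp
    also have "\<dots> \<le> \<epsilon> * h x" using dm elim(1) by (intro mult_right_mono) auto
    finally show ?case by (simp add: m_def)
  qed
qed

lemma long_tailed_fun_self_ratio:
  assumes "long_tailed_fun h"
  shows "((\<lambda>x. h x / h x) \<longlongrightarrow> 1) at_top"
proof (rule tendsto_eventually)
  have "\<forall>\<^sub>F x in at_top. h x > 0" using assms by (simp add: long_tailed_fun_def)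
  then show "\<forall>\<^sub>F x in at_top. h x / h x = 1" by eventually_elim simp
qed

context defective_renewal
begin

lemma measurable_G_window [measurable]: "(\<lambda>x. measure G {x<..x+T}) \<in> borel_measurable borel"
  by (rule measurable_window[OF finite_measure_G sets_G])

lemma measurable_U_window [measurable]: "(\<lambda>x. measure U {x<..x+T}) \<in> borel_measurable borel"
  by (rule measurable_window[OF finite_measure_U sets_U])

lemma G_integral_pos:
  assumes [measurable]: "f \<in> borel_measurable borel"
  shows "(LINT y:{..a}|G. f y :: real) = (LINT y:{0<..a}|G. f y)"
proof -
  note [measurable_cong] = sets_G
  show ?thesis unfolding set_lebesgue_integral_def
    by (rule integral_cong_AE) (use AE_G_pos in \<open>auto simp: indicator_def\<close>)
qed

lemma U_integral_nonneg:
  assumes [measurable]: "f \<in> borel_measurable borel"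
  shows "(LINT y:{..a}|U. f y :: real) = (LINT y:{0..a}|U. f y)"
  unfolding set_lebesgue_integral_def
  by (rule integral_cong_AE) (use AE_U_nonneg in \<open>auto simp: indicator_def\<close>)

lemma measure_G_split:
  assumes "0 \<le> a"
  shows "measure G {0<..a} = \<theta> - measure G {a<..}"
proof -
  have *: "{0<..} = {0<..a} \<union> {a<..}" using assms by auto
  have "measure G {0<..} = measure G {0<..a} + measure G {a<..}"
    unfolding * by (rule G.finite_measure_Union) (auto simp: sets_G)
  then show ?thesis by (simp add: measure_G_pos)
qed

lemma measure_U_split:
  assumes "0 \<le> a"
  shows "measure U {0..a} = 1 / (1 - \<theta>) - measure U {a<..}"
proof -
  have "emeasure U {0..} = emeasure U UNIV"
    by (rule emeasure_eq_AE) (use AE_U_nonneg in auto)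
  then have u: "measure U {0..} = 1 / (1 - \<theta>)" using measure_U_UNIV by (simp add: measure_def)
  have *: "{0..} = {0..a} \<union> {a<..}" using assms by auto
  have "measure U {0..} = measure U {0..a} + measure U {a<..}"
    unfolding * by (rule U.finite_measure_Union) auto
  then show ?thesis by (simp add: u)
qed

text \<open>The long window is covered by windows of length T, each eventually at most q times 2
  h(x) by long-tailedness. It pays for jumps that land within a bounded distance of x, where the
  unknown function is bounded only by a constant.\<close>

lemma measure_G_block:
  assumes lt: "long_tailed_fun h" and T: "0 < T" and q: "0 \<le> q"
    and le: "\<forall>\<^sub>F x in at_top. measure G {x<..x+T} \<le> q * h x"
  shows "\<forall>\<^sub>F x in at_top. measure G {x - a<..x+T} \<le> q * (2 * real (Suc (nat \<lceil>a / T\<rceil>))) * h x"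
proof -
  define n where "n = nat \<lceil>a / T\<rceil>"
  have n: "a \<le> real n * T" using T unfolding n_def by (simp add: pos_divide_le_eq[symmetric] real_nat_ceiling_ge)
  have cover: "measure G {x - real m * T<..x+T} \<le> (\<Sum>k\<le>m. measure G {x - real k * T<..x - real k * T + T})" for m x
  proof (induction m)
    case (Suc m)
    let ?L = "{x - real (Suc m) * T<..x - real (Suc m) * T + T}" and ?R = "{x - real m * T<..x+T}"
    have "measure G {x - real (Suc m) * T<..x+T} \<le> measure G (?L \<union> ?R)"
      by (rule G.finite_measure_mono) (auto simp: sets_G algebra_simps)
    also have "\<dots> \<le> measure G ?L + measure G ?R"
      by (rule measure_Un_le) (auto simp: sets_G)
    finally show ?case using Suc by simp
  qed simp
  have hpos: "\<forall>\<^sub>F x in at_top. h x > 0" using lt by (simp add: long_tailed_fun_def)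
  from hpos long_tailed_fun_uniform[OF lt zero_less_one, of "real n * T"] eventually_at_top_shift[OF le, of "real n * T"]
  show ?thesis
  proof eventually_elim
    case (elim x)
    have each: "measure G {x - real k * T<..x - real k * T + T} \<le> q * (2 * h x)" if "k \<le> n" for k
    proof -
      have k: "real k * T \<in> {0..real n * T}" using that T by (auto intro!: mult_right_mono)
      have "measure G {x - real k * T<..x - real k * T + T} \<le> q * h (x - real k * T)" using elim(3) k by auto
      also have "\<dots> \<le> q * (2 * h x)"
        using elim(2) k q by (intro mult_left_mono) (force simp: abs_le_iff)+
      finally show ?thesis .
    qed
    have "measure G {x - a<..x+T} \<le> measure G {x - real n * T<..x+T}"
      by (rule G.finite_measure_mono) (use n in \<open>auto simp: sets_G\<close>)
    also note cover[of x n]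
    also have "(\<Sum>k\<le>n. measure G {x - real k * T<..x - real k * T + T}) \<le> (\<Sum>k\<le>n. q * (2 * h x))"
      by (rule sum_mono) (use each in auto)
    finally show ?case by (simp add: n_def algebra_simps)
  qed
qed

end

text \<open>Subexponentiality of G/\<theta> without the normalisation: windows of G carry a factor
  \<theta> and windows of its convolution square a factor \<theta>^2, which turns the limit 2 into 2
  \<theta>.\<close>

locale subexponential_renewal = defective_renewal +
  fixes T :: real
  assumes T_pos: "0 < T"
    and window_long_tailed: "long_tailed_fun (\<lambda>x. measure G {x<..x+T})"
    and window_convolution:
      "((\<lambda>x. measure (convolution G G) {x<..x+T} / measure G {x<..x+T}) \<longlongrightarrow> 2 * \<theta>) at_top"
begin

abbreviation "w \<equiv> \<lambda>x. measure G {x<..x+T}"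

lemma w_pos: "\<forall>\<^sub>F x in at_top. 0 < w x"
  using window_long_tailed by (simp add: long_tailed_fun_def)

text \<open>The strips near the two axes contribute almost \<theta> w(x) each, which already
  exhausts the limit 2 \<theta>.\<close>

lemma far_GG_small:
  assumes e: "0 < \<epsilon>"
  shows "\<exists>a0. \<forall>a\<ge>a0. \<forall>\<^sub>F x in at_top. GG.far a T x \<le> \<epsilon> * w x"
proof -
  \<comment> \<open>One d for the convolution limit, and twice (once per strip) one d for the near
    integral and one for the mass of G beyond a0.\<close>
  define d where "d = \<epsilon> / 5"
  have d: "0 < d" using e by (simp add: d_def)
  obtain a1 where a1: "\<forall>a\<ge>a1. measure G {a<..} \<le> d"
    using finite_measure_tail_small[OF finite_measure_G sets_G d] by blast
  define a0 where "a0 = max a1 0"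
  have a0: "0 \<le> a0" "measure G {a0<..} \<le> d" using a1 by (auto simp: a0_def)
  have "\<forall>\<^sub>F x in at_top. dist (measure (convolution G G) {x<..x+T} / w x) (2 * \<theta>) < d"
    using window_convolution d by (simp add: tendsto_iff)
  moreover have "\<forall>\<^sub>F x in at_top. \<bar>(LINT y:{0<..a0}|G. w (x - y)) - 1 * w x * measure G {0<..a0}\<bar> \<le> d * w x"
    by (rule set_integral_near[OF finite_measure_G sets_G measurable_G_window window_long_tailed
          long_tailed_fun_self_ratio[OF window_long_tailed] _ _ d, where a=a0]) auto
  moreover note w_pos eventually_ge_at_top[of "2 * a0"]
  ultimately have main: "\<forall>\<^sub>F x in at_top. GG.far a0 T x \<le> \<epsilon> * w x"
  proof eventually_elim
    case (elim x)
    have [measurable]: "(\<lambda>y. w (x - y)) \<in> borel_measurable borel"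
      by (rule measurable_compose[OF _ measurable_G_window]) simp
    have "measure (convolution G G) {x<..x+T} = 2 * (LINT y:{0<..a0}|G. w (x - y)) + GG.far a0 T x"
      using GG.far_decomp[OF elim(4), of T] by (simp add: G_integral_pos)
    moreover have "measure (convolution G G) {x<..x+T} \<le> (2 * \<theta> + d) * w x"
      using elim(1,3) by (simp add: dist_real_def abs_less_iff field_simps)
    moreover have "w x * measure G {0<..a0} \<ge> w x * (\<theta> - d)"
      using a0 elim(3) by (intro mult_left_mono) (auto simp: measure_G_split)
    ultimately have "GG.far a0 T x \<le> 5 * d * w x"
      using elim(2,3) by (simp add: abs_le_iff algebra_simps)
    then show ?case by (simp add: d_def)
  qed
  have "\<forall>\<^sub>F x in at_top. GG.far a T x \<le> \<epsilon> * w x" if "a \<ge> a0" for a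
    using main by eventually_elim (use GG.far_antimono[OF that, of T] order_trans in blast)
  then show ?thesis by blast
qed

lemma window_U_bound: "\<exists>K\<ge>0. \<forall>\<^sub>F x0 in at_top. \<forall>x\<ge>x0. measure U {x<..x+T} \<le> K * w x"
proof -
  \<comment> \<open>Makes the contraction factor \<theta> + 2 d = (1 + \<theta>) / 2, one d being
    spent near 0 and one on the far part.\<close>
  define d where "d = (1 - \<theta>) / 4"
  have d: "0 < d" using \<theta>_less_1 by (simp add: d_def)
  obtain a0 where a0: "\<forall>a\<ge>a0. \<forall>\<^sub>F x in at_top. GG.far a T x \<le> d * w x"
    using far_GG_small[OF d] by blast
  define a where "a = max a0 0"
  have a: "0 \<le> a" "\<forall>\<^sub>F x in at_top. GG.far a T x \<le> d * w x" using a0 by (auto simp: a_def)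
  obtain x0 where x0: "x0 \<ge> a" "\<forall>X. \<exists>\<delta>>0. \<forall>x\<in>{x0..X}. \<delta> \<le> w x"
  proof -
    from eventually_conj[OF long_tailed_fun_bounded_below[OF window_long_tailed] eventually_ge_at_top[of a]]
    obtain x0 where "(\<forall>X. \<exists>\<delta>>0. \<forall>x\<in>{x0..X}. \<delta> \<le> w x) \<and> a \<le> x0"
      unfolding eventually_at_top_linorder by blast
    then show ?thesis using that by blast
  qed
  \<comment> \<open>The constant of \<open>measure_G_block\<close> for q = 1 and a block reaching
    back by x0.\<close>
  define B where "B = 2 * real (Suc (nat \<lceil>x0 / T\<rceil>))"
  have "\<exists>K\<ge>0. \<forall>x\<ge>x0. measure U {x<..x+T} \<le> K * w x"
  proof (rule bounded_ratio[OF finite_measure_G sets_G measurable_U_window measurable_G_window])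
    show "\<exists>B. \<forall>x\<in>{x0..X}. \<bar>measure U {x<..x+T}\<bar> \<le> B" for X
      using U.bounded_measure by auto
    show "\<exists>B. \<forall>x\<in>{x0..X}. \<bar>w x\<bar> \<le> B" for X using G.bounded_measure by auto
    show "\<exists>\<delta>>0. \<forall>x\<in>{x0..X}. \<delta> \<le> w x" for X using x0 by blast
    show "\<theta> + 2 * d < 1" using \<theta>_less_1 by (simp add: d_def field_simps)
    have "\<forall>\<^sub>F x in at_top. \<bar>(LINT y:{0<..a}|G. w (x - y)) - 1 * w x * measure G {0<..a}\<bar> \<le> d * w x"
      by (rule set_integral_near[OF finite_measure_G sets_G measurable_G_window window_long_tailed
            long_tailed_fun_self_ratio[OF window_long_tailed] _ _ d, where a=a]) auto
    with a(2) w_pos show "\<forall>\<^sub>F x in at_top. (LINT y:{0<..x - x0}|G. w (x - y)) \<le> (\<theta> + 2 * d) * w x"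
    proof eventually_elim
      case (elim x)
      let ?Q = "\<lambda>y w. x < y + w \<and> y + w \<le> x + T"
      have s: "{(y, w). y \<in> {0<..a} \<and> ?Q y w} \<in> sets (G \<Otimes>\<^sub>M G)" "{(y, w). a < y \<and> a < w \<and> ?Q y w} \<in> sets (G \<Otimes>\<^sub>M G)"
        using GG.strip_set[of "{0<..a}" UNIV x T] GG.strip_set[of "{a<..}" "{a<..}" x T] by simp_all
      have "(LINT y:{0<..x - x0}|G. w (x - y)) = measure (G \<Otimes>\<^sub>M G) {(y, w). y \<in> {0<..x - x0} \<and> ?Q y w}"
        by (rule GG.measure_strip_fst[symmetric]) simp
      \<comment> \<open>If a < y \<le> x - x0, then w > x - y \<ge> x0 \<ge> a, so both coordinates
        exceed a.\<close>
      also have "\<dots> \<le> measure (G \<Otimes>\<^sub>M G) ({(y, w). y \<in> {0<..a} \<and> ?Q y w} \<union> {(y, w). a < y \<and> a < w \<and> ?Q y w})"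
        by (rule GG.P.finite_measure_mono) (use s x0(1) in auto)
      also have "\<dots> \<le> measure (G \<Otimes>\<^sub>M G) {(y, w). y \<in> {0<..a} \<and> ?Q y w} + GG.far a T x"
        unfolding GG.far_def by (rule measure_Un_le) (use s in auto)
      also have "measure (G \<Otimes>\<^sub>M G) {(y, w). y \<in> {0<..a} \<and> ?Q y w} = (LINT y:{0<..a}|G. w (x - y))"
        by (rule GG.measure_strip_fst) simp
      finally have 1: "(LINT y:{0<..x - x0}|G. w (x - y)) \<le> (LINT y:{0<..a}|G. w (x - y)) + GG.far a T x" .
      have 2: "w x * measure G {0<..a} \<le> w x * \<theta>"
        using a elim(2) by (intro mult_left_mono) (auto simp: measure_G_split)
      have "(\<theta> + 2 * d) * w x = w x * \<theta> + d * w x + d * w x" by (simp add: algebra_simps)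
      with 1 2 elim(1,3) show ?case by linarith
    qed
    have "\<forall>\<^sub>F x in at_top. measure G {x - x0<..x + T} \<le> 1 * B * w x"
      unfolding B_def by (rule measure_G_block[OF window_long_tailed T_pos]) auto
    then show "\<forall>\<^sub>F x in at_top. measure U {x<..x+T}
        \<le> (B / (1 - \<theta>)) * w x + (LINT y:{0<..x - x0}|G. measure U {x - y<..x - y + T})"
      using eventually_ge_at_top[of 0]
    proof eventually_elim
      case (elim x)
      have "measure U {x<..x+T} = measure (G \<Otimes>\<^sub>M U) {(y, w). y \<in> UNIV \<and> x < y + w \<and> y + w \<le> x + T}"
        using measure_U_window[OF elim(2), of T] GU.measure_convolution_window[of x T] by simp
      also have "\<dots> = (LINT y:UNIV|G. measure U {x - y<..x - y + T})"
        by (rule GU.measure_strip_fst) simp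
      also have "\<dots> = (LINT y|G. measure U {x - y<..x - y + T})"
        by (simp add: set_lebesgue_integral_def)
      also have "\<dots> \<le> (LINT y|G. indicator {0<..x - x0} y * measure U {x - y<..x - y + T}
           + indicator {x - x0<..x + T} y * (1 / (1 - \<theta>)))"
      proof (rule integral_mono_AE)
        show "integrable G (\<lambda>y. measure U {x - y<..x - y + T})"
          using GU.window_integrable[of UNIV U x T] finite_measure_U by (simp add: set_integrable_def)
        show "integrable G (\<lambda>y. indicator {0<..x - x0} y * measure U {x - y<..x - y + T}
           + indicator {x - x0<..x + T} y * (1 / (1 - \<theta>)))"
          using GU.window_integrable[of "{0<..x - x0}" U x T] finite_measure_U
          by (intro Bochner_Integration.integrable_add integrable_mult_left)
             (auto simp: set_integrable_def sets_G less_top[symmetric])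
        show "AE y in G. measure U {x - y<..x - y + T} \<le> indicator {0<..x - x0} y * measure U {x - y<..x - y + T}
           + indicator {x - x0<..x + T} y * (1 / (1 - \<theta>))"
          using AE_G_pos
        proof eventually_elim
          fix y :: real assume y: "0 < y"
          \<comment> \<open>Early jumps keep their integrand; jumps close to x are charged the total
            mass 1 / (1 - \<theta>) of U; jumps beyond x + T leave a window on the negative axis,
            where U vanishes.\<close>
          consider "y \<le> x - x0" | "x - x0 < y" "y \<le> x + T" | "x - x0 < y" "y > x + T" by linarith
          then show "measure U {x - y<..x - y + T} \<le> indicator {0<..x - x0} y * measure U {x - y<..x - y + T}
           + indicator {x - x0<..x + T} y * (1 / (1 - \<theta>))"
          proof cases
            case 2
            have "measure U {x - y<..x - y + T} \<le> measure U UNIV" using U.bounded_measure by simp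
            then show ?thesis using 2 by (simp add: measure_U_UNIV)
          next
            case 3
            then have "measure U {x - y<..x - y + T} \<le> measure U {..<0}"
              by (intro U.finite_measure_mono) auto
            also have "measure U {..<0} = 0" by (simp add: measure_def emeasure_U conv_pow_neg)
            finally show ?thesis using 3 by simp
          qed (use y \<theta>_less_1 in simp)
        qed
      qed
      also have "\<dots> = (LINT y:{0<..x - x0}|G. measure U {x - y<..x - y + T}) + measure G {x - x0<..x + T} * (1 / (1 - \<theta>))"
        using GU.window_integrable[of "{0<..x - x0}" U x T] finite_measure_U
        by (subst Bochner_Integration.integral_add)
           (auto simp: set_integrable_def set_lebesgue_integral_def sets_G space_G less_top[symmetric])
      also have "measure G {x - x0<..x + T} * (1 / (1 - \<theta>)) \<le> (1 * B * w x) * (1 / (1 - \<theta>))"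
        using elim \<theta>_less_1 by (intro mult_right_mono) auto
      finally show ?case by (simp add: algebra_simps)
    qed
  qed
  then obtain K where K: "K \<ge> 0" "\<forall>x\<ge>x0. measure U {x<..x+T} \<le> K * w x" by blast
  then have "\<forall>\<^sub>F x0 in at_top. \<forall>x\<ge>x0. measure U {x<..x+T} \<le> K * w x"
    unfolding eventually_at_top_linorder by (intro exI[of _ x0]) auto
  with K(1) show ?thesis by blast
qed

text \<open>Far out a U window is at most K times a G window, so integrating over the first jump
  reduces the far mass of (G, U) to that of (G, G).\<close>

lemma far_GU_small:
  assumes e: "0 < \<epsilon>"
  shows "\<exists>a0. \<forall>a\<ge>a0. \<forall>\<^sub>F x in at_top. GU.far a T x \<le> \<epsilon> * w x"
proof -
  obtain K where K: "K \<ge> 0" "\<forall>\<^sub>F x0 in at_top. \<forall>x\<ge>x0. measure U {x<..x+T} \<le> K * w x"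
    using window_U_bound by blast
  then obtain x0 where x0: "\<forall>x\<ge>x0. measure U {x<..x+T} \<le> K * w x"
    unfolding eventually_at_top_linorder by blast
  have d: "0 < \<epsilon> / (K + 1)" using e K by simp
  obtain a0 where a0: "\<forall>a\<ge>a0. \<forall>\<^sub>F x in at_top. GG.far a T x \<le> \<epsilon> / (K + 1) * w x"
    using far_GG_small[OF d] by blast
  have "\<forall>\<^sub>F x in at_top. GU.far a T x \<le> \<epsilon> * w x" if a: "a \<ge> max a0 x0 + T" for a
  proof -
    have "\<forall>\<^sub>F x in at_top. GG.far (a - T) T x \<le> \<epsilon> / (K + 1) * w x" using a0 a by auto
    then show ?thesis
    proof eventually_elim
      case (elim x)
      \<comment> \<open>From w > a and y + w \<le> x + T follows y < x - (a - T). Replacing the U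
        window by the G window loses the information w > a and retains only w > x - y > a - T, hence
        the threshold a - T.\<close>
      let ?Q = "\<lambda>y w. x < y + w \<and> y + w \<le> x + T" and ?S = "{a<..<x - (a - T)}"
      have s: "{(y, w). y \<in> ?S \<and> ?Q y w} \<in> sets (G \<Otimes>\<^sub>M U)"
         "{(y, w). a - T < y \<and> a - T < w \<and> ?Q y w} \<in> sets (G \<Otimes>\<^sub>M G)"
        using GU.strip_set[of ?S UNIV x T] GG.strip_set[of "{a - T<..}" "{a - T<..}" x T] by simp_all
      have "GU.far a T x \<le> measure (G \<Otimes>\<^sub>M U) {(y, w). y \<in> ?S \<and> ?Q y w}"
        unfolding GU.far_def by (rule GU.P.finite_measure_mono) (use s in auto)
      also have "\<dots> = (LINT y:?S|G. measure U {x - y<..x - y + T})"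
        by (rule GU.measure_strip_fst) simp
      also have "\<dots> \<le> (LINT y:?S|G. K * w (x - y))"
        by (rule set_integral_mono)
           (use GU.window_integrable[of ?S U x T] GG.window_integrable[of ?S G x T] x0 a in
            \<open>auto simp: finite_measure_U finite_measure_G sets_G\<close>)
      also have "\<dots> = K * measure (G \<Otimes>\<^sub>M G) {(y, w). y \<in> ?S \<and> ?Q y w}"
        by (subst GG.measure_strip_fst) simp_all
      also have "measure (G \<Otimes>\<^sub>M G) {(y, w). y \<in> ?S \<and> ?Q y w} \<le> GG.far (a - T) T x"
        unfolding GG.far_def by (rule GG.P.finite_measure_mono) (use s T_pos in auto)
      finally have "GU.far a T x \<le> K * (\<epsilon> / (K + 1) * w x)"
        using K elim by (meson mult_left_mono order_trans)
      also have "\<dots> = K / (K + 1) * (\<epsilon> * w x)" by simp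
      also have "\<dots> \<le> 1 * (\<epsilon> * w x)" using K e by (intro mult_right_mono) auto
      finally show ?case by simp
    qed
  qed
  then show ?thesis by blast
qed

text \<open>A first jump up to a reproduces the U window, and a bounded remainder contributes almost
  w(x) times the total mass of U; so \<open>ratio_limit\<close> applies with c = 1 / (1 - \<theta>).
  The thirds of \<epsilon> go to the far part, the tail of U and the long-tailed
  replacement.\<close>

lemma window_U_limit: "((\<lambda>x. measure U {x<..x+T} / w x) \<longlongrightarrow> 1 / (1 - \<theta>)\<^sup>2) at_top"
proof -
  let ?u = "\<lambda>x. measure U {x<..x+T}"
  obtain K where K: "\<forall>\<^sub>F x0 in at_top. \<forall>x\<ge>x0. ?u x \<le> K * w x"
    using window_U_bound by blast
  have "((\<lambda>x. ?u x / w x) \<longlongrightarrow> (1 / (1 - \<theta>)) / (1 - \<theta>)) at_top"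
  proof (rule ratio_limit[OF finite_measure_G sets_G measure_G_pos \<theta>_less_1 measurable_U_window window_long_tailed])
    show "\<forall>\<^sub>F x in at_top. \<bar>?u x\<bar> \<le> K * w x" using K by eventually_elim simp
    fix \<epsilon> :: real assume e: "0 < \<epsilon>"
    then have d: "0 < \<epsilon> / 3" by simp
    obtain a1 a2 a3 where a1: "\<forall>a\<ge>a1. measure G {a<..} \<le> \<epsilon>" and a2: "\<forall>a\<ge>a2. measure U {a<..} \<le> \<epsilon> / 3"
      and a3: "\<forall>a\<ge>a3. \<forall>\<^sub>F x in at_top. GU.far a T x \<le> \<epsilon> / 3 * w x"
      using finite_measure_tail_small[OF finite_measure_G sets_G e]
        finite_measure_tail_small[OF finite_measure_U sets_U d] far_GU_small[OF d] by blast
    define a where "a = max (max a1 a2) (max a3 0)"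
    have a: "measure G {a<..} \<le> \<epsilon>" "measure U {a<..} \<le> \<epsilon> / 3" "0 \<le> a"
       "\<forall>\<^sub>F x in at_top. GU.far a T x \<le> \<epsilon> / 3 * w x"
      using a1 a2 a3 by (auto simp: a_def)
    have "\<forall>\<^sub>F x in at_top. \<bar>(LINT y:{0..a}|U. w (x - y)) - 1 * w x * measure U {0..a}\<bar> \<le> \<epsilon> / 3 * w x"
      by (rule set_integral_near[OF finite_measure_U sets_U measurable_G_window window_long_tailed
            long_tailed_fun_self_ratio[OF window_long_tailed] _ _ d, where a=a]) auto
    with a(4) w_pos eventually_ge_at_top[of "2 * a"]
    have "\<forall>\<^sub>F x in at_top. \<bar>?u x - 1 / (1 - \<theta>) * w x - (LINT y:{0<..a}|G. ?u (x - y))\<bar> \<le> \<epsilon> * w x"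
    proof eventually_elim
      case (elim x)
      have [measurable]: "(\<lambda>y. w (x - y)) \<in> borel_measurable borel" "(\<lambda>y. ?u (x - y)) \<in> borel_measurable borel"
        by (rule measurable_compose[OF _ measurable_G_window] measurable_compose[OF _ measurable_U_window], simp)+
      have "?u x = (LINT y:{0<..a}|G. ?u (x - y)) + (LINT y:{0..a}|U. w (x - y)) + GU.far a T x"
        using measure_U_window[of x T] GU.far_decomp[OF elim(3), of T] elim(3) a(3)
        by (simp add: G_integral_pos U_integral_nonneg)
      moreover have "0 \<le> GU.far a T x" by (rule GU.far_nonneg)
      moreover have "w x * measure U {0..a} = 1 / (1 - \<theta>) * w x - w x * measure U {a<..}"
        by (simp add: measure_U_split[OF a(3)] algebra_simps)
      moreover have "w x * measure U {a<..} \<le> w x * (\<epsilon> / 3)" "0 \<le> w x * measure U {a<..}"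
        using a(2) elim(2) by (auto intro!: mult_left_mono)
      moreover have "\<bar>(LINT y:{0..a}|U. w (x - y)) - w x * measure U {0..a}\<bar> \<le> \<epsilon> * w x / 3"
        using elim(4) by simp
      moreover have "w x * (\<epsilon> / 3) = \<epsilon> * w x / 3" "GU.far a T x \<le> \<epsilon> * w x / 3"
        using elim(1) by simp_all
      ultimately show ?case by linarith
    qed
    with a show "\<exists>a. measure G {a<..} \<le> \<epsilon> \<and> 0 \<le> a \<and>
        (\<forall>\<^sub>F x in at_top. \<bar>?u x - 1 / (1 - \<theta>) * w x - (LINT y:{0<..a}|G. ?u (x - y))\<bar> \<le> \<epsilon> * w x)"
      by blast
  qed
  then show ?thesis by (simp add: power2_eq_square)
qed

end

section \<open>The renewal equation\<close>

lemma set_integral_mono_subset: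
  fixes f :: "'a \<Rightarrow> real"
  assumes "set_integrable M B f" "A \<in> sets M" "A \<subseteq> B" "\<And>x. x \<in> B \<Longrightarrow> 0 \<le> f x"
  shows "(LINT x:A|M. f x) \<le> (LINT x:B|M. f x)"
proof -
  have "set_integrable M A f" by (rule set_integrable_subset[OF assms(1-3)])
  then show ?thesis using assms(1,3,4)
    unfolding set_lebesgue_integral_def set_integrable_def
    by (intro integral_mono) (auto simp: indicator_def)
qed

text \<open>A common shape for the constants below; b + 1 instead of b admits b = 0.\<close>

lemma half_quotient:
  fixes b e :: real
  assumes "0 \<le> b" "0 < e"
  shows "0 < e / (2 * (b + 1))" "b * (e / (2 * (b + 1))) \<le> e / 2"
proof -
  show "0 < e / (2 * (b + 1))" using assms by simp
  have "b * (e / (2 * (b + 1))) = b / (b + 1) * (e / 2)" by simp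
  also have "\<dots> \<le> 1 * (e / 2)" using assms by (intro mult_right_mono) auto
  finally show "b * (e / (2 * (b + 1))) \<le> e / 2" by simp
qed

lemma ennreal_set_integral:
  fixes f :: "'a \<Rightarrow> real"
  assumes "set_integrable M A f" "\<And>x. x \<in> A \<Longrightarrow> 0 \<le> f x"
  shows "ennreal (LINT x:A|M. f x) = (\<integral>\<^sup>+x. indicator A x * ennreal (f x) \<partial>M)"
proof -
  have "(\<integral>\<^sup>+x. ennreal (indicat_real A x *\<^sub>R f x) \<partial>M) = ennreal (LINT x:A|M. f x)"
    unfolding set_lebesgue_integral_def
    by (rule nn_integral_eq_integral) (use assms in \<open>auto simp: set_integrable_def indicator_def\<close>)
  moreover have "(\<integral>\<^sup>+x. ennreal (indicat_real A x *\<^sub>R f x) \<partial>M) = (\<integral>\<^sup>+x. indicator A x * ennreal (f x) \<partial>M)"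
    by (intro nn_integral_cong) (auto simp: indicator_def)
  ultimately show ?thesis by simp
qed

locale renewal_equation = defective_renewal +
  fixes z :: "real \<Rightarrow> real"
  assumes z_meas [measurable]: "z \<in> borel_measurable borel"
    and z_nonneg: "\<And>x. 0 \<le> x \<Longrightarrow> 0 \<le> z x"
    and z_lb: "locally_bounded z"
begin

abbreviation "Z \<equiv> renewal_sol G z"

lemma z_bounded: "\<exists>B\<ge>0. \<forall>x\<in>{0..a}. z x \<le> B"
proof -
  obtain B where "\<forall>x\<in>{0..a}. \<bar>z x\<bar> \<le> B" using z_lb unfolding locally_bounded_def by blast
  then show ?thesis by (intro exI[of _ "\<bar>B\<bar>"]) (auto simp: abs_le_iff intro: order_trans)
qed

lemma z_integrable:
  assumes "finite_measure M" "sets M = sets borel" "S \<in> sets borel" "S \<subseteq> {..x}" "bdd_below S"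
  shows "set_integrable M S (\<lambda>y. z (x - y))"
proof -
  interpret finite_measure M by fact
  note [measurable_cong] = assms(2)
  obtain b where b: "\<And>y. y \<in> S \<Longrightarrow> b \<le> y" using assms(5) by (auto simp: bdd_below_def)
  obtain B where "\<forall>v\<in>{0..x - b}. \<bar>z v\<bar> \<le> B" using z_lb unfolding locally_bounded_def by blast
  then show ?thesis
    by (intro set_integrable_bounded[where B=B]) (use assms b in force)+
qed

text \<open>The extended value before \<open>enn2real\<close>, with a conditional in place of the
  indicator of an x-dependent set, so that joint measurability in x and y is automatic.\<close>

definition "\<phi> x = (\<integral>\<^sup>+y. (if 0 \<le> y \<and> y \<le> x then ennreal (z (x - y)) else 0) \<partial>U)"

lemma Z_eq_\<phi>: "Z x = enn2real (\<phi> x)"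
  unfolding renewal_sol_def \<phi>_def
  by (intro arg_cong[where f=enn2real] nn_integral_cong) (auto simp: indicator_def)

lemma \<phi>_meas [measurable]: "\<phi> \<in> borel_measurable borel"
  unfolding \<phi>_def[abs_def] by measurable

lemma Z_meas [measurable]: "Z \<in> borel_measurable borel"
proof -
  have "(\<lambda>x. enn2real (\<phi> x)) \<in> borel_measurable borel" by measurable
  then show ?thesis by (simp add: Z_eq_\<phi>[symmetric])
qed

text \<open>\<open>z\<close> is bounded on [0, x] and U is finite, so the value 0 that
  \<open>enn2real\<close> assigns to infinity never occurs through overflow.\<close>

lemma \<phi>_eq: "\<phi> x = ennreal (Z x)"
proof -
  obtain B where B: "B \<ge> 0" "\<forall>v\<in>{0..x}. z v \<le> B" using z_bounded by blast
  have "\<phi> x \<le> (\<integral>\<^sup>+y. ennreal B \<partial>U)"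
    unfolding \<phi>_def by (intro nn_integral_mono) (use B in auto)
  also have "\<dots> < \<top>" by (simp add: emeasure_U_UNIV ennreal_mult_less_top)
  finally show ?thesis by (simp add: Z_eq_\<phi>)
qed

lemma Z_nonneg: "0 \<le> Z x" by (simp add: Z_eq_\<phi>)

lemma Z_integral: "Z x = (LINT y:{0..x}|U. z (x - y))"
proof -
  have "ennreal (LINT y:{0..x}|U. z (x - y)) = (\<integral>\<^sup>+y. indicator {0..x} y * ennreal (z (x - y)) \<partial>U)"
    by (rule ennreal_set_integral[OF z_integrable]) (use z_nonneg in \<open>auto simp: finite_measure_U\<close>)
  moreover have "0 \<le> (LINT y:{0..x}|U. z (x - y))"
    unfolding set_lebesgue_integral_def
    by (intro Bochner_Integration.integral_nonneg) (use z_nonneg in \<open>auto simp: indicator_def\<close>)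
  ultimately show ?thesis unfolding renewal_sol_def by (metis enn2real_ennreal)
qed

lemma Z_bounded: "\<exists>B\<ge>0. \<forall>x\<le>a. Z x \<le> B"
proof -
  obtain B where B: "B \<ge> 0" "\<forall>v\<in>{0..a}. z v \<le> B" using z_bounded by blast
  have "Z x \<le> B * (1 / (1 - \<theta>))" if "x \<le> a" for x
  proof -
    have "\<phi> x \<le> (\<integral>\<^sup>+y. ennreal B \<partial>U)"
      unfolding \<phi>_def by (intro nn_integral_mono) (use B that in auto)
    also have "\<dots> = ennreal (B * (1 / (1 - \<theta>)))" using B \<theta>_less_1 by (simp add: emeasure_U_UNIV ennreal_mult[symmetric])
    finally show ?thesis using B \<theta>_less_1 by (simp add: \<phi>_eq)
  qed
  then show ?thesis using B \<theta>_less_1 by (intro exI[of _ "B * (1 / (1 - \<theta>))"]) auto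
qed

lemma Z_integrable:
  assumes "S \<in> sets borel" "bdd_below S"
  shows "set_integrable G S (\<lambda>y. Z (x - y))"
proof -
  note [measurable_cong] = sets_G
  obtain b where b: "\<And>y. y \<in> S \<Longrightarrow> b \<le> y" using assms(2) by (auto simp: bdd_below_def)
  obtain B where "\<forall>v\<le>x - b. Z v \<le> B" using Z_bounded by blast
  then show ?thesis
    by (intro G.set_integrable_bounded[where B=B]) (use assms b Z_nonneg in \<open>auto simp: sets_G\<close>)
qed

text \<open>In \<open>nn_integral_U_eq\<close> for v \<mapsto> z(x - v) on [0, x], the atom at 0
  produces z(x), and after a first jump y the inner integral is the same functional at x - y, which
  vanishes for y > x.\<close>

lemma renewal_eq:
  assumes x: "0 \<le> x"
  shows "Z x = z x + (LINT y:{0<..x}|G. Z (x - y))"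
proof -
  define f where "f v = (if 0 \<le> v \<and> v \<le> x then ennreal (z (x - v)) else 0)" for v
  have [measurable]: "f \<in> borel_measurable borel" unfolding f_def[abs_def] by measurable
  have "\<phi> x = f 0 + (\<integral>\<^sup>+y. \<integral>\<^sup>+w. f (y + w) \<partial>U \<partial>G)"
    using nn_integral_U_eq[of f] by (simp add: \<phi>_def f_def)
  also have "(\<integral>\<^sup>+y. \<integral>\<^sup>+w. f (y + w) \<partial>U \<partial>G) = (\<integral>\<^sup>+y. indicator {0<..x} y * ennreal (Z (x - y)) \<partial>G)"
  proof (rule nn_integral_cong_AE, use AE_G_pos in eventually_elim)
    fix y :: real assume y: "0 < y"
    have "(\<integral>\<^sup>+w. f (y + w) \<partial>U) = \<phi> (x - y)"
      unfolding \<phi>_def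
      by (rule nn_integral_cong_AE, use AE_U_nonneg in eventually_elim)
         (use y in \<open>auto simp: f_def algebra_simps\<close>)
    moreover have "\<phi> (x - y) = 0" if "y > x"
    proof -
      have "(if 0 \<le> w \<and> w \<le> x - y then ennreal (z (x - y - w)) else 0) = 0" for w using that by auto
      then show ?thesis unfolding \<phi>_def by (simp only: nn_integral_const) simp
    qed
    ultimately show "(\<integral>\<^sup>+w. f (y + w) \<partial>U) = indicator {0<..x} y * ennreal (Z (x - y))"
      using y by (auto simp: indicator_def \<phi>_eq)
  qed
  also have "\<dots> = ennreal (LINT y:{0<..x}|G. Z (x - y))"
    by (rule ennreal_set_integral[symmetric, OF Z_integrable]) (auto simp: Z_nonneg)
  also have "f 0 = ennreal (z x)" using x by (simp add: f_def)
  finally have "ennreal (Z x) = ennreal (z x) + ennreal (LINT y:{0<..x}|G. Z (x - y))" by (simp add: \<phi>_eq)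
  also have "\<dots> = ennreal (z x + (LINT y:{0<..x}|G. Z (x - y)))"
    by (subst ennreal_plus) (use z_nonneg x in \<open>auto simp: Z_nonneg set_lebesgue_integral_def intro!: Bochner_Integration.integral_nonneg\<close>)
  finally show ?thesis
    by (subst (asm) ennreal_inj)
       (use z_nonneg x in \<open>auto simp: Z_nonneg set_lebesgue_integral_def intro!: Bochner_Integration.integral_nonneg add_nonneg_nonneg\<close>)
qed

end

section \<open>Part (iii): the inhomogeneity dominates the windows of G\<close>

locale density_dominated = renewal_equation +
  fixes xh C :: real
  assumes z_long_tailed: "long_tailed_fun z"
    and g_negligible: "((\<lambda>x. measure G {x<..x+1} / z x) \<longlongrightarrow> 0) at_top"
    and xh: "0 \<le> xh" and C: "0 \<le> C"
    and z_convolution: "\<forall>\<^sub>F x in at_top. (LINT y:{xh..x - xh}|lborel. z (x - y) * z y) \<le> C * z x"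
begin

lemma z_pos: "\<forall>\<^sub>F x in at_top. 0 < z x"
  using z_long_tailed by (simp add: long_tailed_fun_def)

lemma g_small: "0 < \<epsilon> \<Longrightarrow> \<forall>\<^sub>F x in at_top. measure G {x<..x+1} \<le> \<epsilon> * z x"
proof -
  assume "0 < \<epsilon>"
  from tendstoD[OF g_negligible this] z_pos show ?thesis
    by eventually_elim (simp add: dist_real_def field_simps)
qed

text \<open>Since \<open>z\<close> is long-tailed, \<open>z(x - y)\<close> is at most twice the integral of \<open>z(x - v)\<close> over
  \<open>v \<in> [y - 1, y)\<close>; exchanging integrals replaces \<open>G(dy)\<close> by \<open>G(v, v + 1] dv\<close>, which is \<open>o(z(v)) dv\<close>.\<close>

lemma middle_small:
  assumes e: "0 < \<epsilon>"
  shows "\<exists>a0. \<forall>a\<ge>a0. \<forall>\<^sub>F x in at_top. (LINT y:{a<..x - a}|G. z (x - y)) \<le> \<epsilon> * z x"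
proof -
  \<comment> \<open>The bound will be 2 d C z(x): 2 from the smearing of z, d from G(v, v + 1] \<le>
    d z(v), C from the convolution of z with itself.\<close>
  define d where "d = \<epsilon> / (2 * (C + 1))"
  have d: "0 < d" "2 * d * C \<le> \<epsilon>"
    using half_quotient[OF C e] by (simp_all add: d_def ac_simps)
  obtain x1 where x1: "\<forall>x\<ge>x1. 0 < z x \<and> (\<forall>t\<in>{0..1}. \<bar>z (x - t) - z x\<bar> \<le> 1 * z x) \<and> measure G {x<..x+1} \<le> d * z x"
    using eventually_conj[OF z_pos eventually_conj[OF long_tailed_fun_step[OF z_long_tailed zero_less_one] g_small[OF d(1)]]]
    unfolding eventually_at_top_linorder by blast
  have dbl: "z w \<le> 2 * z (w + t)" if "w \<ge> x1" "t \<in> {0..1}" for w t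
  proof -
    have "w + t \<ge> x1" using that by simp
    then have "\<bar>z ((w + t) - t) - z (w + t)\<bar> \<le> 1 * z (w + t)" using x1 that by blast
    then show ?thesis by (simp add: abs_le_iff)
  qed
  \<comment> \<open>The unit of room in a is needed because v may lie one unit below y: v > a - 1
    still exceeds x1 and xh, and v < y \<le> x - a stays below x - xh.\<close>
  have "\<forall>\<^sub>F x in at_top. (LINT y:{a<..x - a}|G. z (x - y)) \<le> \<epsilon> * z x" if a: "x1 + 1 \<le> a" "xh + 1 \<le> a" for a
    using z_convolution z_pos
  proof eventually_elim
    case (elim x)
    note [measurable_cong] = sets_G
    have GL: "pair_sigma_finite G lborel"
      by (intro pair_sigma_finite.intro G.sigma_finite_measure lborel.sigma_finite_measure_axioms)
    let ?S = "{a<..x - a}"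
    have "ennreal (LINT y:?S|G. z (x - y)) = (\<integral>\<^sup>+y. indicator ?S y * ennreal (z (x - y)) \<partial>G)"
    proof (rule ennreal_set_integral)
      show "set_integrable G ?S (\<lambda>y. z (x - y))"
      proof (rule z_integrable[OF finite_measure_G sets_G])
        show "?S \<subseteq> {..x}" using a xh by (intro subsetI) simp
      qed simp_all
      show "0 \<le> z (x - y)" if "y \<in> ?S" for y
        by (rule z_nonneg) (use that a xh in simp)
    qed
    also have "\<dots> \<le> (\<integral>\<^sup>+y. \<integral>\<^sup>+v. (if a < y \<and> y \<le> x - a \<and> v < y \<and> y \<le> v + 1 then ennreal (2 * z (x - v)) else 0) \<partial>lborel \<partial>G)"
    proof (rule nn_integral_mono)
      fix y
      show "indicator ?S y * ennreal (z (x - y))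
         \<le> (\<integral>\<^sup>+v. (if a < y \<and> y \<le> x - a \<and> v < y \<and> y \<le> v + 1 then ennreal (2 * z (x - v)) else 0) \<partial>lborel)"
      proof (cases "y \<in> ?S")
        case True
        have "ennreal (z (x - y)) = (\<integral>\<^sup>+v. ennreal (z (x - y)) * indicator {y - 1..<y} v \<partial>lborel)"
          by (simp add: nn_integral_cmult_indicator)
        also have "\<dots> \<le> (\<integral>\<^sup>+v. (if a < y \<and> y \<le> x - a \<and> v < y \<and> y \<le> v + 1 then ennreal (2 * z (x - v)) else 0) \<partial>lborel)"
        proof (rule nn_integral_mono)
          fix v
          have "z (x - y) \<le> 2 * z (x - v)" if "v \<in> {y - 1..<y}"
            using dbl[of "x - y" "y - v"] that True a by auto
          then show "ennreal (z (x - y)) * indicator {y - 1..<y} v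
             \<le> (if a < y \<and> y \<le> x - a \<and> v < y \<and> y \<le> v + 1 then ennreal (2 * z (x - v)) else 0)"
            using True by (auto simp: indicator_def intro!: ennreal_leI)
        qed
        finally show ?thesis using True by simp
      qed simp
    qed
    also have "\<dots> = (\<integral>\<^sup>+v. \<integral>\<^sup>+y. (if a < y \<and> y \<le> x - a \<and> v < y \<and> y \<le> v + 1 then ennreal (2 * z (x - v)) else 0) \<partial>G \<partial>lborel)"
      by (rule pair_sigma_finite.Fubini'[OF GL, symmetric]) measurable
    also have "\<dots> \<le> (\<integral>\<^sup>+v. ennreal (2 * d) * (indicator {xh..x - xh} v * ennreal (z (x - v) * z v)) \<partial>lborel)"
    proof (rule nn_integral_mono)
      fix v
      show "(\<integral>\<^sup>+y. (if a < y \<and> y \<le> x - a \<and> v < y \<and> y \<le> v + 1 then ennreal (2 * z (x - v)) else 0) \<partial>G)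
         \<le> ennreal (2 * d) * (indicator {xh..x - xh} v * ennreal (z (x - v) * z v))"
      proof (cases "a - 1 \<le> v \<and> v \<le> x - a")
        case True
        have "(\<integral>\<^sup>+y. (if a < y \<and> y \<le> x - a \<and> v < y \<and> y \<le> v + 1 then ennreal (2 * z (x - v)) else 0) \<partial>G)
          \<le> (\<integral>\<^sup>+y. ennreal (2 * z (x - v)) * indicator {v<..v+1} y \<partial>G)"
          by (intro nn_integral_mono) (auto simp: indicator_def)
        also have "\<dots> = ennreal (2 * z (x - v)) * ennreal (measure G {v<..v+1})"
          by (simp add: nn_integral_cmult_indicator sets_G G.emeasure_eq_measure)
        also have "\<dots> \<le> ennreal (2 * z (x - v)) * ennreal (d * z v)"
          using x1 True a by (intro mult_left_mono ennreal_leI) auto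
        also have "\<dots> = ennreal (2 * d) * ennreal (z (x - v) * z v)"
          using True a xh z_nonneg[of v] z_nonneg[of "x - v"] d by (simp add: ennreal_mult[symmetric] ac_simps)
        finally show ?thesis using True a xh by (simp add: indicator_def)
      next
        case False
        then have "(if a < y \<and> y \<le> x - a \<and> v < y \<and> y \<le> v + 1 then ennreal (2 * z (x - v)) else 0) = 0" for y
          by auto
        then show ?thesis by (simp only: nn_integral_const) simp
      qed
    qed
    also have "\<dots> = ennreal (2 * d) * (\<integral>\<^sup>+v. indicator {xh..x - xh} v * ennreal (z (x - v) * z v) \<partial>lborel)"
      by (rule nn_integral_cmult) measurable
    also have "(\<integral>\<^sup>+v. indicator {xh..x - xh} v * ennreal (z (x - v) * z v) \<partial>lborel)
        = ennreal (LINT v:{xh..x - xh}|lborel. z (x - v) * z v)"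
    proof (rule ennreal_set_integral[symmetric])
      obtain B where B: "0 \<le> B" "\<forall>v\<in>{0..x}. z v \<le> B" using z_bounded by blast
      then have "\<forall>v\<in>{0..x}. \<bar>z v\<bar> \<le> B" by (simp add: z_nonneg)
      with B(1) have B: "0 \<le> B" "\<forall>v\<in>{0..x}. \<bar>z v\<bar> \<le> B" .
      show "set_integrable lborel {xh..x - xh} (\<lambda>v. z (x - v) * z v)"
        unfolding set_integrable_def
      proof (rule integrableI_bounded_set_indicator[where B="B * B"])
        show "AE v in lborel. v \<in> {xh..x - xh} \<longrightarrow> norm (z (x - v) * z v) \<le> B * B"
          using B xh by (intro AE_I2) (auto simp: abs_mult intro!: mult_mono)
      qed (auto simp: emeasure_lborel_Icc_eq)
      show "0 \<le> z (x - v) * z v" if "v \<in> {xh..x - xh}" for v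
        using z_nonneg[of v] z_nonneg[of "x - v"] xh that by auto
    qed
    also have "ennreal (2 * d) * \<dots> \<le> ennreal (2 * d) * ennreal (C * z x)"
      using elim by (intro mult_left_mono ennreal_leI) auto
    also have "\<dots> = ennreal (2 * d * C * z x)" using d C elim by (simp add: ennreal_mult[symmetric] ac_simps)
    finally have "(LINT y:?S|G. z (x - y)) \<le> 2 * d * C * z x"
      using d C elim by (subst (asm) ennreal_le_iff) auto
    also have "\<dots> \<le> \<epsilon> * z x" using d elim by (intro mult_right_mono) auto
    finally show ?case .
  qed
  then show ?thesis by (intro exI[of _ "max (x1 + 1) (xh + 1)"]) auto
qed

text \<open>The supremum argument with z as the scale. Jumps in (x - x0, x] leave Z at arguments
  below x0, where it is at most a constant B, and their mass is O(z(x)) by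
  \<open>measure_G_block\<close>.\<close>

lemma Z_le_z: "\<exists>K\<ge>0. \<forall>\<^sub>F x0 in at_top. \<forall>x\<ge>x0. Z x \<le> K * z x"
proof -
  define d where "d = (1 - \<theta>) / 4"
  have d: "0 < d" using \<theta>_less_1 by (simp add: d_def)
  obtain a0 where a0: "\<forall>a\<ge>a0. \<forall>\<^sub>F x in at_top. (LINT y:{a<..x - a}|G. z (x - y)) \<le> d * z x"
    using middle_small[OF d] by blast
  define a where "a = max a0 0"
  have a: "0 \<le> a" "\<forall>\<^sub>F x in at_top. (LINT y:{a<..x - a}|G. z (x - y)) \<le> d * z x" using a0 by (auto simp: a_def)
  obtain x0 where x0: "x0 \<ge> a" "\<forall>X. \<exists>\<delta>>0. \<forall>x\<in>{x0..X}. \<delta> \<le> z x"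
  proof -
    from eventually_conj[OF long_tailed_fun_bounded_below[OF z_long_tailed] eventually_ge_at_top[of a]]
    obtain x0 where "(\<forall>X. \<exists>\<delta>>0. \<forall>x\<in>{x0..X}. \<delta> \<le> z x) \<and> a \<le> x0"
      unfolding eventually_at_top_linorder by blast
    then show ?thesis using that by blast
  qed
  obtain B where B: "B \<ge> 0" "\<forall>v\<le>x0. Z v \<le> B" using Z_bounded by blast
  define N where "N = 2 * real (Suc (nat \<lceil>x0 / 1\<rceil>))"
  have "\<exists>K\<ge>0. \<forall>x\<ge>x0. Z x \<le> K * z x"
  proof (rule bounded_ratio[OF finite_measure_G sets_G Z_meas z_meas])
    show "\<exists>B. \<forall>x\<in>{x0..X}. \<bar>Z x\<bar> \<le> B" for X
      using Z_bounded[of X] Z_nonneg by fastforce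
    show "\<exists>B. \<forall>x\<in>{x0..X}. \<bar>z x\<bar> \<le> B" for X
      using z_lb[unfolded locally_bounded_def, rule_format, of X] x0 a by fastforce
    show "\<exists>\<delta>>0. \<forall>x\<in>{x0..X}. \<delta> \<le> z x" for X using x0 by blast
    show "\<theta> + 2 * d < 1" using \<theta>_less_1 by (simp add: d_def field_simps)
    have "\<forall>\<^sub>F x in at_top. \<bar>(LINT y:{0<..a}|G. z (x - y)) - 1 * z x * measure G {0<..a}\<bar> \<le> d * z x"
      by (rule set_integral_near[OF finite_measure_G sets_G z_meas z_long_tailed
            long_tailed_fun_self_ratio[OF z_long_tailed] _ _ d, where a=a]) auto
    with a(2) z_pos eventually_ge_at_top[of "2 * a"]
    show "\<forall>\<^sub>F x in at_top. (LINT y:{0<..x - x0}|G. z (x - y)) \<le> (\<theta> + 2 * d) * z x"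
    proof eventually_elim
      case (elim x)
      have int: "set_integrable G S (\<lambda>y. z (x - y))" if "S = {0<..x - a} \<or> S = {0<..a} \<or> S = {a<..x - a}" for S
        by (rule z_integrable[OF finite_measure_G sets_G]) (use that a elim(3) in auto)
      have "(LINT y:{0<..x - x0}|G. z (x - y)) \<le> (LINT y:{0<..x - a}|G. z (x - y))"
        by (rule set_integral_mono_subset[OF int]) (use a x0 z_nonneg in \<open>auto simp: sets_G\<close>)
      also have "{0<..x - a} = {0<..a} \<union> {a<..x - a}" using a elim(3) by auto
      also have "(LINT y:\<dots>|G. z (x - y)) = (LINT y:{0<..a}|G. z (x - y)) + (LINT y:{a<..x - a}|G. z (x - y))"
        by (rule set_integral_Un) (use int in auto)
      finally have 1: "(LINT y:{0<..x - x0}|G. z (x - y)) \<le> \<dots>" .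
      have 2: "z x * measure G {0<..a} \<le> z x * \<theta>"
        using a elim(2) by (intro mult_left_mono) (auto simp: measure_G_split)
      have "(\<theta> + 2 * d) * z x = z x * \<theta> + d * z x + d * z x" by (simp add: algebra_simps)
      with 1 2 elim(1,4) show ?case by linarith
    qed
    have "\<forall>\<^sub>F x in at_top. measure G {x - x0<..x + 1} \<le> 1 * N * z x"
      unfolding N_def by (rule measure_G_block[OF z_long_tailed]) (use g_small[of 1] in auto)
    then show "\<forall>\<^sub>F x in at_top. Z x \<le> (1 + B * N) * z x + (LINT y:{0<..x - x0}|G. Z (x - y))"
      using eventually_ge_at_top[of x0]
    proof eventually_elim
      case (elim x)
      have *: "{0<..x} = {0<..x - x0} \<union> {x - x0<..x}" using elim a x0 by auto
      have "Z x = z x + (LINT y:{0<..x}|G. Z (x - y))" using renewal_eq elim a x0 by auto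
      also have "(LINT y:{0<..x}|G. Z (x - y)) = (LINT y:{0<..x - x0}|G. Z (x - y)) + (LINT y:{x - x0<..x}|G. Z (x - y))"
        unfolding * by (rule set_integral_Un) (auto intro!: Z_integrable)
      also have "(LINT y:{x - x0<..x}|G. Z (x - y)) \<le> (LINT y:{x - x0<..x}|G. B)"
        by (rule set_integral_mono[OF Z_integrable]) (use B in \<open>auto simp: set_integrable_def sets_G less_top[symmetric]\<close>)
      also have "\<dots> = B * measure G {x - x0<..x}"
        by (subst set_integral_const) (auto simp: sets_G less_top[symmetric])
      also have "\<dots> \<le> B * measure G {x - x0<..x + 1}"
        using B by (intro mult_left_mono G.finite_measure_mono) (auto simp: sets_G)
      also have "\<dots> \<le> B * (1 * N * z x)" using B elim by (intro mult_left_mono) auto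
      finally show ?case by (simp add: algebra_simps)
    qed
  qed
  then obtain K where K: "K \<ge> 0" "\<forall>x\<ge>x0. Z x \<le> K * z x" by blast
  then have "\<forall>\<^sub>F x0 in at_top. \<forall>x\<ge>x0. Z x \<le> K * z x"
    unfolding eventually_at_top_linorder by (intro exI[of _ x0]) auto
  with K(1) show ?thesis by blast
qed

text \<open>The equation has z itself as its leading term, so c = 1 in \<open>ratio_limit\<close>.
  Jumps in (a, x - a] are controlled through Z \<le> K z and \<open>middle_small\<close>, jumps in
  (x - a, x] through the negligibility of G windows; each costs half of \<epsilon>.\<close>

lemma Z_limit: "((\<lambda>x. Z x / z x) \<longlongrightarrow> 1 / (1 - \<theta>)) at_top"
proof -
  obtain K where K: "K \<ge> 0" "\<forall>\<^sub>F x0 in at_top. \<forall>x\<ge>x0. Z x \<le> K * z x"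
    using Z_le_z by blast
  obtain x0 where x0: "\<forall>x\<ge>x0. Z x \<le> K * z x"
    using K(2) unfolding eventually_at_top_linorder by blast
  show ?thesis
  proof (rule ratio_limit[OF finite_measure_G sets_G measure_G_pos \<theta>_less_1 Z_meas z_long_tailed])
    show "\<forall>\<^sub>F x in at_top. \<bar>Z x\<bar> \<le> K * z x" using K(2) by eventually_elim (simp add: Z_nonneg)
    fix \<epsilon> :: real assume e: "0 < \<epsilon>"
    define d where "d = \<epsilon> / (2 * (K + 1))"
    have d: "0 < d" "K * d \<le> \<epsilon> / 2" using half_quotient[OF K(1) e] by (simp_all add: d_def)
    obtain a1 a2 where a1: "\<forall>a\<ge>a1. measure G {a<..} \<le> \<epsilon>"
      and a2: "\<forall>a\<ge>a2. \<forall>\<^sub>F x in at_top. (LINT y:{a<..x - a}|G. z (x - y)) \<le> d * z x"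
      using finite_measure_tail_small[OF finite_measure_G sets_G e] middle_small[OF d(1)] by blast
    define a where "a = max (max a1 a2) (max x0 0)"
    have a: "measure G {a<..} \<le> \<epsilon>" "0 \<le> a" "x0 \<le> a"
       "\<forall>\<^sub>F x in at_top. (LINT y:{a<..x - a}|G. z (x - y)) \<le> d * z x"
      using a1 a2 by (auto simp: a_def)
    obtain B where B: "B \<ge> 0" "\<forall>v\<le>a. Z v \<le> B" using Z_bounded by blast
    define N where "N = 2 * real (Suc (nat \<lceil>a / 1\<rceil>))"
    have N: "N > 0" by (simp add: N_def)
    \<comment> \<open>B and N depend on a, so q is chosen after a; this is possible because G(x, x +
      1] is eventually below q z(x) for every positive q.\<close>
    define q where "q = \<epsilon> / (2 * (B + 1)) / N"
    have q: "0 < q" "B * (q * N) \<le> \<epsilon> / 2"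
      using divide_pos_pos[OF half_quotient(1)[OF B(1) e] N] half_quotient(2)[OF B(1) e] N
      by (simp_all add: q_def)
    have "\<forall>\<^sub>F x in at_top. measure G {x - a<..x + 1} \<le> q * N * z x"
      unfolding N_def by (rule measure_G_block[OF z_long_tailed]) (use g_small[OF q(1)] q in auto)
    with a(4) z_pos eventually_ge_at_top[of "2 * a"]
    have "\<forall>\<^sub>F x in at_top. \<bar>Z x - 1 * z x - (LINT y:{0<..a}|G. Z (x - y))\<bar> \<le> \<epsilon> * z x"
    proof eventually_elim
      case (elim x)
      have *: "{0<..x} = ({0<..a} \<union> {a<..x - a}) \<union> {x - a<..x}" using elim a by auto
      have "(LINT y:{0<..x}|G. Z (x - y)) = (LINT y:{0<..a} \<union> {a<..x - a}|G. Z (x - y)) + (LINT y:{x - a<..x}|G. Z (x - y))"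
        unfolding * by (rule set_integral_Un) (use elim a in \<open>auto intro!: Z_integrable\<close>)
      also have "(LINT y:{0<..a} \<union> {a<..x - a}|G. Z (x - y)) = (LINT y:{0<..a}|G. Z (x - y)) + (LINT y:{a<..x - a}|G. Z (x - y))"
        by (rule set_integral_Un) (auto intro!: Z_integrable)
      finally have eq: "Z x - 1 * z x - (LINT y:{0<..a}|G. Z (x - y))
          = (LINT y:{a<..x - a}|G. Z (x - y)) + (LINT y:{x - a<..x}|G. Z (x - y))"
        using renewal_eq[of x] elim a by simp
      have "(LINT y:{a<..x - a}|G. Z (x - y)) \<le> (LINT y:{a<..x - a}|G. K * z (x - y))"
        by (rule set_integral_mono[OF Z_integrable])
           (use x0 a in \<open>auto intro!: set_integrable_mult_right z_integrable finite_measure_G simp: sets_G\<close>)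
      also have "\<dots> = K * (LINT y:{a<..x - a}|G. z (x - y))" by simp
      also have "\<dots> \<le> K * (d * z x)" using K elim by (intro mult_left_mono) auto
      also have "\<dots> = (K * d) * z x" by simp
      also have "\<dots> \<le> \<epsilon> / 2 * z x" using d elim by (intro mult_right_mono) auto
      finally have 1: "(LINT y:{a<..x - a}|G. Z (x - y)) \<le> \<epsilon> / 2 * z x" .
      have "(LINT y:{x - a<..x}|G. Z (x - y)) \<le> (LINT y:{x - a<..x}|G. B)"
        by (rule set_integral_mono[OF Z_integrable]) (use B in \<open>auto simp: set_integrable_def sets_G less_top[symmetric]\<close>)
      also have "\<dots> = B * measure G {x - a<..x}"
        by (subst set_integral_const) (auto simp: sets_G less_top[symmetric])
      also have "\<dots> \<le> B * measure G {x - a<..x + 1}"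
        using B by (intro mult_left_mono G.finite_measure_mono) (auto simp: sets_G)
      also have "\<dots> \<le> B * (q * N * z x)" using B elim by (intro mult_left_mono) auto
      also have "\<dots> = (B * (q * N)) * z x" by simp
      also have "\<dots> \<le> \<epsilon> / 2 * z x" using q elim by (intro mult_right_mono) auto
      finally have 2: "(LINT y:{x - a<..x}|G. Z (x - y)) \<le> \<epsilon> / 2 * z x" .
      have "0 \<le> (LINT y:S|G. Z (x - y))" for S
        unfolding set_lebesgue_integral_def by (intro Bochner_Integration.integral_nonneg) (simp add: Z_nonneg)
      then show ?case unfolding eq using 1 2 by simp
    qed
    with a show "\<exists>a. measure G {a<..} \<le> \<epsilon> \<and> 0 \<le> a \<and>
        (\<forall>\<^sub>F x in at_top. \<bar>Z x - 1 * z x - (LINT y:{0<..a}|G. Z (x - y))\<bar> \<le> \<epsilon> * z x)"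
      by blast
  qed
qed

end

section \<open>Directly Riemann integrable inhomogeneities\<close>

lemma long_tailed_fun_shift:
  assumes h: "long_tailed_fun h" and s: "0 \<le> s"
  shows "((\<lambda>x. h (x - s) / h x) \<longlongrightarrow> 1) at_top"
proof (rule tendstoI)
  fix e :: real assume e: "0 < e"
  have "\<forall>\<^sub>F x in at_top. h x > 0" using h by (simp add: long_tailed_fun_def)
  with long_tailed_fun_uniform[OF h half_gt_zero[OF e], of s]
  show "\<forall>\<^sub>F x in at_top. dist (h (x - s) / h x) 1 < e"
  proof eventually_elim
    case (elim x)
    have "\<bar>h (x - s) - h x\<bar> \<le> e / 2 * h x" using elim s by auto
    also have "\<dots> < e * h x" using elim e by simp
    finally have "\<bar>h (x - s) - h x\<bar> / h x < e" using elim by (simp add: pos_divide_less_eq)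
    moreover have "\<bar>h (x - s) / h x - 1\<bar> = \<bar>h (x - s) - h x\<bar> / h x"
      using elim by (simp add: field_simps)
    ultimately show ?case by (simp add: dist_real_def)
  qed
qed

text \<open>This lemma and the next pass between limits of quotients and division-free inequalities,
  whose errors can simply be added.\<close>

lemma tendsto_ratioI:
  fixes f h :: "real \<Rightarrow> real"
  assumes pos: "\<forall>\<^sub>F x in F. 0 < h x"
    and le: "\<And>e. 0 < e \<Longrightarrow> \<forall>\<^sub>F x in F. \<bar>f x - L * h x\<bar> \<le> e * h x"
  shows "((\<lambda>x. f x / h x) \<longlongrightarrow> L) F"
proof (rule tendstoI)
  fix e :: real assume e: "0 < e"
  from pos le[OF half_gt_zero[OF e]] show "\<forall>\<^sub>F x in F. dist (f x / h x) L < e"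
  proof eventually_elim
    case (elim x)
    have "e / 2 * h x < e * h x" using elim e by simp
    then have "\<bar>f x - L * h x\<bar> / h x < e" using elim by (simp add: pos_divide_less_eq)
    moreover have "\<bar>f x / h x - L\<bar> = \<bar>f x - L * h x\<bar> / h x"
      using elim by (simp add: field_simps)
    ultimately show ?case by (simp add: dist_real_def)
  qed
qed

lemma eventually_le_of_ratio_tendsto:
  fixes f h :: "real \<Rightarrow> real"
  assumes "\<forall>\<^sub>F x in F. 0 < h x" "((\<lambda>x. f x / h x) \<longlongrightarrow> L) F" "0 < e"
  shows "\<forall>\<^sub>F x in F. \<bar>f x - L * h x\<bar> \<le> e * h x"
  using assms(1) tendstoD[OF assms(2,3)]
proof eventually_elim
  case (elim x)
  have "\<bar>f x / h x - L\<bar> = \<bar>f x - L * h x\<bar> / h x" using elim by (simp add: field_simps)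
  then have "\<bar>f x - L * h x\<bar> / h x < e" using elim by (simp add: dist_real_def)
  then show ?case using elim by (simp add: pos_divide_less_eq)
qed

text \<open>Countable additivity of the measure with density z. The cells are half-open to be
  disjoint, whereas the suprema and infima in \<open>dRi\<close> run over closed ones.\<close>

lemma nn_integral_cells:
  fixes z :: "real \<Rightarrow> real"
  assumes [measurable]: "z \<in> borel_measurable borel" and h: "0 < h"
  shows "(\<integral>\<^sup>+y. indicator {0..} y * ennreal (z y) \<partial>lborel)
       = (\<Sum>n. \<integral>\<^sup>+y. indicator {real n * h..<real (Suc n) * h} y * ennreal (z y) \<partial>lborel)"
proof -
  define N where "N = density lborel (\<lambda>y. ennreal (z y))"
  have N: "emeasure N A = (\<integral>\<^sup>+y. indicator A y * ennreal (z y) \<partial>lborel)" if "A \<in> sets borel" for A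
    unfolding N_def using that by (subst emeasure_density) (auto simp: mult.commute)
  have cells: "(\<Union>n. {real n * h..<real (Suc n) * h}) = {0..}"
  proof (intro equalityI subsetI)
    fix y :: real assume y: "y \<in> {0..}"
    then have "0 \<le> y / h" using h by simp
    then have "real (nat \<lfloor>y / h\<rfloor>) \<le> y / h" "y / h < real (Suc (nat \<lfloor>y / h\<rfloor>))" by linarith+
    then have "y \<in> {real (nat \<lfloor>y / h\<rfloor>) * h..<real (Suc (nat \<lfloor>y / h\<rfloor>)) * h}"
      using h by (simp add: pos_le_divide_eq pos_divide_less_eq del: of_nat_Suc)
    then show "y \<in> (\<Union>n. {real n * h..<real (Suc n) * h})" by blast
  next
    fix y assume "y \<in> (\<Union>n. {real n * h..<real (Suc n) * h})"
    then obtain n where "real n * h \<le> y" by auto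
    then show "y \<in> {0..}" using h by (smt (verit) atLeast_iff mult_nonneg_nonneg of_nat_0_le_iff)
  qed
  have "disjoint_family (\<lambda>n. {real n * h..<real (Suc n) * h})"
    unfolding disjoint_family_on_def
  proof (intro ballI impI)
    have *: "{real m * h..<real (Suc m) * h} \<inter> {real n * h..<real (Suc n) * h} = {}" if "m < n" for m n
    proof -
      have "real (Suc m) * h \<le> real n * h" using that h by (intro mult_right_mono) auto
      then show ?thesis by auto
    qed
    fix m n :: nat assume "m \<noteq> n"
    then show "{real m * h..<real (Suc m) * h} \<inter> {real n * h..<real (Suc n) * h} = {}"
      using *[of m n] *[of n m] by (cases m n rule: linorder_cases) auto
  qed
  then have "(\<Sum>n. emeasure N {real n * h..<real (Suc n) * h}) = emeasure N {0..}"
    by (subst suminf_emeasure) (auto simp: cells N_def simp del: of_nat_Suc)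
  then show ?thesis by (simp add: N)
qed

text \<open>The new cell keeps the form (v, v + h], which is the shape of a window.\<close>

lemma Ioc_Suc_cell:
  fixes h x :: real
  assumes "0 < h"
  shows "{x - real (Suc m) * h<..x} = {x - real (Suc m) * h<..x - real (Suc m) * h + h} \<union> {x - real m * h<..x}"
proof -
  define v where "v = real m * h"
  have "0 \<le> v" using assms by (simp add: v_def)
  moreover have "real (Suc m) * h = v + h" by (simp add: v_def algebra_simps)
  ultimately show ?thesis using assms unfolding v_def[symmetric] by auto
qed

lemma dRi_cell_bounds:
  assumes dRi: "dRi z" and h: "0 < h" and y: "y \<in> {real n * h..real (Suc n) * h}"
  shows "lower_dR z h n \<le> z y" "z y \<le> upper_dR z h n"
  using assms unfolding dRi_def upper_dR_def lower_dR_def by (auto intro!: cINF_lower cSUP_upper)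

text \<open>Cellwise comparison with the constants \<open>lower_dR\<close> and
  \<open>upper_dR\<close>. It links direct Riemann integrability to the Lebesgue integral.\<close>

lemma dRi_sums:
  fixes z :: "real \<Rightarrow> real"
  assumes dRi: "dRi z" and z [measurable]: "z \<in> borel_measurable borel"
    and nonneg: "\<And>x. 0 \<le> x \<Longrightarrow> 0 \<le> z x" and h: "0 < h"
  defines "I \<equiv> enn2real (\<integral>\<^sup>+ y. indicator {0..} y * ennreal (z y) \<partial>lborel)"
  shows "h * (\<Sum>n. lower_dR z h n) \<le> I" "I \<le> h * (\<Sum>n. upper_dR z h n)"
proof -
  have su: "summable (upper_dR z h)" and sl: "summable (lower_dR z h)"
    using dRi h by (auto simp: dRi_def)
  have pos: "0 \<le> y" if "y \<in> {real n * h..real (Suc n) * h}" for y n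
    using that h by (smt (verit) atLeastAtMost_iff mult_nonneg_nonneg of_nat_0_le_iff)
  have mem: "real n * h \<in> {real n * h..real (Suc n) * h}" for n using h by (simp add: algebra_simps)
  have l0: "0 \<le> lower_dR z h n" for n
    unfolding lower_dR_def by (rule cINF_greatest) (use mem nonneg pos in auto)
  have u0: "0 \<le> upper_dR z h n" for n
    using dRi_cell_bounds[OF dRi h mem[of n]] nonneg[OF pos[OF mem[of n]]] by linarith
  let ?J = "\<integral>\<^sup>+ y. indicator {0..} y * ennreal (z y) \<partial>lborel"
  have cell: "(\<integral>\<^sup>+y. indicator {real n * h..<real (Suc n) * h} y * ennreal c \<partial>lborel) = ennreal (h * c)"
    if "0 \<le> c" for c n
  proof -
    have "(\<integral>\<^sup>+y. indicator {real n * h..<real (Suc n) * h} y * ennreal c \<partial>lborel)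
        = (\<integral>\<^sup>+y. ennreal c * indicator {real n * h..<real (Suc n) * h} y \<partial>lborel)"
      by (simp add: mult.commute)
    also have "\<dots> = ennreal c * ennreal (real (Suc n) * h - real n * h)"
      using h by (subst nn_integral_cmult_indicator) (auto simp: algebra_simps)
    also have "real (Suc n) * h - real n * h = h" by (simp add: algebra_simps)
    finally show ?thesis using that h by (simp add: ennreal_mult[symmetric] mult.commute)
  qed
  have "?J = (\<Sum>n. \<integral>\<^sup>+y. indicator {real n * h..<real (Suc n) * h} y * ennreal (z y) \<partial>lborel)"
    by (rule nn_integral_cells[OF z h])
  also have "\<dots> \<le> (\<Sum>n. ennreal (h * upper_dR z h n))"
  proof (intro suminf_le summableI)
    fix n
    have "(\<integral>\<^sup>+y. indicator {real n * h..<real (Suc n) * h} y * ennreal (z y) \<partial>lborel)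
        \<le> (\<integral>\<^sup>+y. indicator {real n * h..<real (Suc n) * h} y * ennreal (upper_dR z h n) \<partial>lborel)"
      using dRi_cell_bounds(2)[OF dRi h]
      by (intro nn_integral_mono) (auto simp: indicator_def simp del: of_nat_Suc intro!: ennreal_leI)
    then show "(\<integral>\<^sup>+y. indicator {real n * h..<real (Suc n) * h} y * ennreal (z y) \<partial>lborel) \<le> ennreal (h * upper_dR z h n)"
      by (simp add: cell[OF u0] del: of_nat_Suc)
  qed
  also have "\<dots> = ennreal (\<Sum>n. h * upper_dR z h n)"
    using h u0 su by (intro suminf_ennreal2) (auto intro: summable_mult)
  also have "(\<Sum>n. h * upper_dR z h n) = h * (\<Sum>n. upper_dR z h n)" by (rule suminf_mult[OF su])
  finally have J: "?J \<le> ennreal (h * (\<Sum>n. upper_dR z h n))" .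
  have "enn2real ?J \<le> enn2real (ennreal (h * (\<Sum>n. upper_dR z h n)))"
    by (rule enn2real_mono[OF J]) simp
  then show "I \<le> h * (\<Sum>n. upper_dR z h n)"
    using h suminf_nonneg[OF su u0] by (simp add: I_def)
  have "ennreal (h * (\<Sum>n. lower_dR z h n)) = ennreal (\<Sum>n. h * lower_dR z h n)"
    by (simp add: suminf_mult[OF sl])
  also have "\<dots> = (\<Sum>n. ennreal (h * lower_dR z h n))"
    using h l0 sl by (intro suminf_ennreal2[symmetric]) (auto intro: summable_mult)
  also have "\<dots> \<le> (\<Sum>n. \<integral>\<^sup>+y. indicator {real n * h..<real (Suc n) * h} y * ennreal (z y) \<partial>lborel)"
  proof (intro suminf_le summableI)
    fix n
    have "(\<integral>\<^sup>+y. indicator {real n * h..<real (Suc n) * h} y * ennreal (lower_dR z h n) \<partial>lborel)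
       \<le> (\<integral>\<^sup>+y. indicator {real n * h..<real (Suc n) * h} y * ennreal (z y) \<partial>lborel)"
      using dRi_cell_bounds(1)[OF dRi h]
      by (intro nn_integral_mono) (auto simp: indicator_def simp del: of_nat_Suc intro!: ennreal_leI)
    then show "ennreal (h * lower_dR z h n) \<le> (\<integral>\<^sup>+y. indicator {real n * h..<real (Suc n) * h} y * ennreal (z y) \<partial>lborel)"
      by (simp add: cell[OF l0] del: of_nat_Suc)
  qed
  also have "\<dots> = ?J" by (rule nn_integral_cells[OF z h, symmetric])
  \<comment> \<open>\<open>enn2real\<close> sends infinity to 0, so its monotonicity needs a finite
    integral; the upper sum provides this through \<open>J\<close>.\<close>
  finally have "enn2real (ennreal (h * (\<Sum>n. lower_dR z h n))) \<le> enn2real ?J"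
    by (rule enn2real_mono) (use J in \<open>auto simp: less_top[symmetric] top_unique\<close>)
  then show "h * (\<Sum>n. lower_dR z h n) \<le> I"
    using h suminf_nonneg[OF sl l0] by (simp add: I_def)
qed

text \<open>The mesh is taken of the form 1/n so that a whole number of cells fills the unit window
  defining g.\<close>

lemma dRi_fine_mesh:
  assumes dRi: "dRi z" and e: "0 < \<epsilon>"
  shows "\<exists>n>0. (1 / real n) * (\<Sum>k. upper_dR z (1 / real n) k)
             \<le> (1 / real n) * (\<Sum>k. lower_dR z (1 / real n) k) + \<epsilon>"
proof -
  have "((\<lambda>h. h * (\<Sum>n. upper_dR z h n) - h * (\<Sum>n. lower_dR z h n)) \<longlongrightarrow> 0) (at_right 0)"
    using dRi by (simp add: dRi_def)
  moreover have "filterlim (\<lambda>n. 1 / real (Suc n)) (at_right 0) sequentially"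
    unfolding filterlim_at using LIMSEQ_Suc[OF lim_1_over_n[where 'a=real]]
    by (auto simp del: of_nat_Suc)
  ultimately have "((\<lambda>n. (1 / real (Suc n)) * (\<Sum>k. upper_dR z (1 / real (Suc n)) k)
     - (1 / real (Suc n)) * (\<Sum>k. lower_dR z (1 / real (Suc n)) k)) \<longlongrightarrow> 0) sequentially"
    by (rule filterlim_compose)
  from order_tendstoD(2)[OF this e] obtain n where
    "(1 / real (Suc n)) * (\<Sum>k. upper_dR z (1 / real (Suc n)) k)
     - (1 / real (Suc n)) * (\<Sum>k. lower_dR z (1 / real (Suc n)) k) < \<epsilon>"
    by (auto simp: eventually_sequentially)
  then show ?thesis by (intro exI[of _ "Suc n"]) linarith
qed

section \<open>Parts (i) and (ii): splitting the integral against U\<close>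

locale subexponential_renewal_equation = renewal_equation +
  assumes subexp: "\<And>T. 0 < T \<Longrightarrow> subexponential_renewal G \<theta> T"
    and dRi: "dRi z"
begin

abbreviation "g \<equiv> \<lambda>x. measure G {x<..x+1}"

lemma g_long_tailed: "long_tailed_fun g"
  using subexponential_renewal.window_long_tailed[OF subexp[of 1]] by simp

lemma g_pos: "\<forall>\<^sub>F x in at_top. 0 < g x"
  using g_long_tailed by (simp add: long_tailed_fun_def)

text \<open>A unit window is made of n windows of length 1/n, all asymptotically equal because the
  short windows are themselves long-tailed. This is where subexponentiality for small T
  enters.\<close>

lemma short_window:
  assumes n: "0 < n"
  shows "((\<lambda>x. measure G {x<..x + 1 / real n} / g x) \<longlongrightarrow> 1 / real n) at_top"
proof -
  define h where "h = 1 / real n"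
  have h: "0 < h" "real n * h = 1" using n by (auto simp: h_def)
  interpret subexponential_renewal G \<theta> h by (rule subexp) (rule h)
  have "measure G {x - real m * h<..x} = (\<Sum>k<m. w (x - real (Suc k) * h))" for m x
  proof (induction m)
    case (Suc m)
    let ?L = "{x - real (Suc m) * h<..x - real (Suc m) * h + h}" and ?R = "{x - real m * h<..x}"
    have e: "{x - real (Suc m) * h<..x} = ?L \<union> ?R" by (rule Ioc_Suc_cell) (rule h)
    have "measure G (?L \<union> ?R) = measure G ?L + measure G ?R"
      by (rule G.finite_measure_Union) (auto simp: sets_G algebra_simps)
    then show ?case unfolding e using Suc by simp
  qed simp
  \<comment> \<open>Counting cells backwards from x produces the unit window ending at x, hence g(x
    - 1), which is then replaced by g(x).\<close>
  from this[of _ n] have sum: "g (x - 1) = (\<Sum>k<n. w (x - real (Suc k) * h))" for x by (simp add: h)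
  have "((\<lambda>x. \<Sum>k<n. w (x - real (Suc k) * h) / w x) \<longlongrightarrow> (\<Sum>k<n. 1)) at_top"
    by (intro tendsto_sum long_tailed_fun_shift[OF window_long_tailed]) (use h in auto)
  then have 1: "((\<lambda>x. g (x - 1) / w x) \<longlongrightarrow> real n) at_top"
    unfolding sum sum_divide_distrib by simp
  have "((\<lambda>x. (g (x - 1) / g x) / (g (x - 1) / w x)) \<longlongrightarrow> 1 / real n) at_top"
    by (rule tendsto_divide[OF long_tailed_fun_shift[OF g_long_tailed] 1]) (use n in auto)
  moreover have "\<forall>\<^sub>F x in at_top. (g (x - 1) / g x) / (g (x - 1) / w x) = w x / g x"
    using eventually_at_top_shift[OF g_pos, of 1] w_pos
  proof eventually_elim
    case (elim x)
    then have "0 < g (x - 1)" "0 < g x" by (auto simp del: diff_add_cancel)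
    then show ?case using elim by (simp add: field_simps)
  qed
  ultimately have "((\<lambda>x. w x / g x) \<longlongrightarrow> 1 / real n) at_top" by (rule Lim_transform_eventually)
  then show ?thesis by (simp add: h_def)
qed

text \<open>Three equivalences are multiplied: U window against G window of the same length, the
  fixed translation by s, and short window against unit window.\<close>

lemma U_cell:
  assumes n: "0 < n" and s: "0 \<le> s"
  shows "((\<lambda>x. measure U {x - s<..x - s + 1 / real n} / g x) \<longlongrightarrow> (1 / real n) * (1 / (1 - \<theta>)\<^sup>2)) at_top"
proof -
  define h where "h = 1 / real n"
  have h: "0 < h" using n by (auto simp: h_def)
  interpret subexponential_renewal G \<theta> h by (rule subexp) (rule h)
  have shift: "filterlim (\<lambda>x. x - s) at_top at_top" for s :: real
    unfolding filterlim_at_top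
  proof
    fix b
    show "\<forall>\<^sub>F x in at_top. b \<le> x - s"
      using eventually_ge_at_top[of "b + s"] by eventually_elim simp
  qed
  have 1: "((\<lambda>x. measure U {x - s<..x - s + h} / w (x - s)) \<longlongrightarrow> 1 / (1 - \<theta>)\<^sup>2) at_top"
    using filterlim_compose[OF window_U_limit shift] .
  have "((\<lambda>x. w x / g x * (w (x - s) / w x) * (measure U {x - s<..x - s + h} / w (x - s)))
     \<longlongrightarrow> h * 1 * (1 / (1 - \<theta>)\<^sup>2)) at_top"
    by (intro tendsto_mult 1 long_tailed_fun_shift[OF window_long_tailed s])
       (use short_window[OF n] in \<open>simp add: h_def\<close>)
  moreover have "\<forall>\<^sub>F x in at_top. w x / g x * (w (x - s) / w x) * (measure U {x - s<..x - s + h} / w (x - s))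
      = measure U {x - s<..x - s + h} / g x"
    using eventually_at_top_shift[OF w_pos, of s]
  proof eventually_elim
    case (elim x)
    then have "0 < w (x - s)" "0 < w x" using s by auto
    then show ?case by simp
  qed
  ultimately have "((\<lambda>x. measure U {x - s<..x - s + h} / g x) \<longlongrightarrow> h * 1 * (1 / (1 - \<theta>)\<^sup>2)) at_top"
    by (rule Lim_transform_eventually)
  then show ?thesis by (simp add: h_def)
qed

text \<open>If y lies in the k-th cell counted back from x, then x - y lies in [k h, (k + 1) h], so
  cellwise bounds on z integrate to sums weighted by U.\<close>

lemma riemann_bounds:
  assumes h: "0 < h"
  shows "(\<Sum>k<N. lower_dR z h k * measure U {x - real (Suc k) * h<..x - real (Suc k) * h + h})
           \<le> (LINT y:{x - real N * h<..x}|U. z (x - y))" (is "?l N \<le> ?i N")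
    and "(LINT y:{x - real N * h<..x}|U. z (x - y))
           \<le> (\<Sum>k<N. upper_dR z h k * measure U {x - real (Suc k) * h<..x - real (Suc k) * h + h})" (is "_ \<le> ?u N")
proof -
  have "?l N \<le> ?i N \<and> ?i N \<le> ?u N"
  proof (induction N)
    case (Suc m)
    let ?L = "{x - real (Suc m) * h<..x - real (Suc m) * h + h}" and ?R = "{x - real m * h<..x}"
    have e: "{x - real (Suc m) * h<..x} = ?L \<union> ?R" by (rule Ioc_Suc_cell) (rule h)
    have int: "set_integrable U ?L (\<lambda>y. z (x - y))" "set_integrable U ?R (\<lambda>y. z (x - y))"
      by (rule z_integrable[OF finite_measure_U sets_U], use Ioc_Suc_cell[OF h, of x m] in auto)+
    have cint: "set_integrable U ?L (\<lambda>y. c)" for c :: real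
      by (auto simp: set_integrable_def less_top[symmetric])
    have c: "(LINT y:?L|U. c) = c * measure U ?L" for c :: real
      by (subst set_integral_const) (auto simp: less_top[symmetric])
    have "?i (Suc m) = (LINT y:?L|U. z (x - y)) + ?i m"
      unfolding e by (rule set_integral_Un[OF _ int]) (auto simp: algebra_simps)
    moreover have cell: "x - y \<in> {real m * h..real (Suc m) * h}" if "y \<in> ?L" for y
      using that by (auto simp: algebra_simps)
    have "(LINT y:?L|U. lower_dR z h m) \<le> (LINT y:?L|U. z (x - y))"
      by (rule set_integral_mono[OF cint int(1)]) (rule dRi_cell_bounds(1)[OF dRi h cell])
    moreover have "(LINT y:?L|U. z (x - y)) \<le> (LINT y:?L|U. upper_dR z h m)"
      by (rule set_integral_mono[OF int(1) cint]) (rule dRi_cell_bounds(2)[OF dRi h cell])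
    ultimately show ?case using Suc by (simp add: c del: of_nat_Suc)
  qed (simp add: set_lebesgue_integral_def)
  then show "?l N \<le> ?i N" "?i N \<le> ?u N" by auto
qed

definition "I = enn2real (\<integral>\<^sup>+ y. indicator {0..} y * ennreal (z y) \<partial>lborel)"

text \<open>The mesh is fixed first, to bring upper and lower sums together, then the number N of
  cells, to make partial sums close to full ones; only then does x grow, with \<open>U_cell\<close>
  applied to finitely many cells. Admitting all N \<ge> N0 allows the end piece to be enlarged to
  meet other cutoffs.\<close>

lemma end_part:
  assumes e: "0 < \<epsilon>"
  shows "\<exists>n>0. \<exists>N0. \<forall>N\<ge>N0. \<forall>\<^sub>F x in at_top.
     \<bar>(LINT y:{x - real N * (1 / real n)<..x}|U. z (x - y)) - I / (1 - \<theta>)\<^sup>2 * g x\<bar> \<le> \<epsilon> * g x"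
proof -
  define c where "c = 1 / (1 - \<theta>)\<^sup>2"
  have c: "0 \<le> c" by (simp add: c_def)
  \<comment> \<open>The Riemann sum error d is multiplied by c; the other half of \<epsilon> is
    spent on the limit in x.\<close>
  define d where "d = \<epsilon> / (2 * (c + 1)) "
  have d: "0 < d" "c * d \<le> \<epsilon> / 2" using half_quotient[OF c e] by (simp_all add: d_def)
  obtain n where n: "0 < n" "(1 / real n) * (\<Sum>k. upper_dR z (1 / real n) k)
             \<le> (1 / real n) * (\<Sum>k. lower_dR z (1 / real n) k) + d / 2"
    using dRi_fine_mesh[OF dRi half_gt_zero[OF d(1)]] by blast
  define h where "h = 1 / real n"
  have h: "0 < h" using n by (simp add: h_def)
  have su: "summable (upper_dR z h)" and sl: "summable (lower_dR z h)"
    using dRi h by (auto simp: dRi_def)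
  have I: "h * (\<Sum>k. lower_dR z h k) \<le> I" "I \<le> h * (\<Sum>k. upper_dR z h k)"
    unfolding I_def by (rule dRi_sums[OF dRi z_meas z_nonneg h]; assumption)+
  have "(\<lambda>N. h * (\<Sum>k<N. lower_dR z h k)) \<longlonglongrightarrow> h * (\<Sum>k. lower_dR z h k)"
    by (intro tendsto_mult tendsto_const summable_LIMSEQ sl)
  moreover have "h * (\<Sum>k. lower_dR z h k) > I - d"
    using n(2) I d by (simp add: h_def)
  ultimately have 1: "\<forall>\<^sub>F N in sequentially. h * (\<Sum>k<N. lower_dR z h k) > I - d"
    by (rule order_tendstoD)
  have "(\<lambda>N. h * (\<Sum>k<N. upper_dR z h k)) \<longlonglongrightarrow> h * (\<Sum>k. upper_dR z h k)"
    by (intro tendsto_mult tendsto_const summable_LIMSEQ su)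
  moreover have "h * (\<Sum>k. upper_dR z h k) < I + d"
    using n(2) I d by (simp add: h_def)
  ultimately have 2: "\<forall>\<^sub>F N in sequentially. h * (\<Sum>k<N. upper_dR z h k) < I + d"
    by (rule order_tendstoD)
  obtain N0 where N0: "\<forall>N\<ge>N0. h * (\<Sum>k<N. lower_dR z h k) > I - d \<and> h * (\<Sum>k<N. upper_dR z h k) < I + d"
    using eventually_conj[OF 1 2] unfolding eventually_sequentially by blast
  have "\<forall>\<^sub>F x in at_top. \<bar>(LINT y:{x - real N * h<..x}|U. z (x - y)) - I * c * g x\<bar> \<le> \<epsilon> * g x"
    if N: "N \<ge> N0" for N
  proof -
    let ?C = "\<lambda>k x. {x - real (Suc k) * h<..x - real (Suc k) * h + h}"
    have lim: "((\<lambda>x. (\<Sum>k<N. f k * measure U (?C k x)) / g x) \<longlongrightarrow> h * (\<Sum>k<N. f k) * c) at_top" for f :: "nat \<Rightarrow> real"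
    proof -
      have "((\<lambda>x. \<Sum>k<N. f k * (measure U (?C k x) / g x)) \<longlongrightarrow> (\<Sum>k<N. f k * (h * c))) at_top"
        using U_cell[OF n(1)] h unfolding h_def c_def by (intro tendsto_sum tendsto_mult tendsto_const) simp
      then show ?thesis by (simp add: sum_divide_distrib sum_distrib_left sum_distrib_right ac_simps del: of_nat_Suc)
    qed
    from eventually_le_of_ratio_tendsto[OF g_pos lim[of "lower_dR z h"] half_gt_zero[OF e]]
      eventually_le_of_ratio_tendsto[OF g_pos lim[of "upper_dR z h"] half_gt_zero[OF e]] g_pos
    show ?thesis
    proof eventually_elim
      case (elim x)
      have "h * (\<Sum>k<N. upper_dR z h k) * c \<le> (I + d) * c"
        using N0 N c by (intro mult_right_mono) (auto intro: less_imp_le)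
      also have "\<dots> \<le> I * c + \<epsilon> / 2" using d by (simp add: algebra_simps)
      finally have "h * (\<Sum>k<N. upper_dR z h k) * c * g x \<le> (I * c + \<epsilon> / 2) * g x"
        using elim(3) by (intro mult_right_mono) auto
      then have u: "h * (\<Sum>k<N. upper_dR z h k) * c * g x \<le> I * c * g x + \<epsilon> / 2 * g x"
        by (simp only: distrib_right)
      have "I * c - \<epsilon> / 2 \<le> (I - d) * c" using d by (simp add: algebra_simps)
      also have "\<dots> \<le> h * (\<Sum>k<N. lower_dR z h k) * c"
        using N0 N c by (intro mult_right_mono) (auto intro: less_imp_le)
      finally have "(I * c - \<epsilon> / 2) * g x \<le> h * (\<Sum>k<N. lower_dR z h k) * c * g x"
        using elim(3) by (intro mult_right_mono) auto
      then have l: "I * c * g x - \<epsilon> / 2 * g x \<le> h * (\<Sum>k<N. lower_dR z h k) * c * g x"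
        by (simp only: left_diff_distrib)
      have "\<epsilon> / 2 * g x + \<epsilon> / 2 * g x = \<epsilon> * g x" by simp
      then show ?case
        using u l elim(1,2) riemann_bounds[OF h, where N=N and x=x] unfolding abs_le_iff by linarith
    qed
  qed
  then show ?thesis using n(1) unfolding h_def c_def by auto
qed

lemma Z_limit:
  assumes c: "0 \<le> c" and lim: "((\<lambda>x. z x / g x) \<longlongrightarrow> c) at_top"
  shows "((\<lambda>x. Z x / g x) \<longlongrightarrow> I / (1 - \<theta>)\<^sup>2 + c / (1 - \<theta>)) at_top"
proof (rule tendsto_ratioI[OF g_pos])
  fix e :: real assume e: "0 < e"
  interpret one: subexponential_renewal G \<theta> 1 by (rule subexp) simp
  define d where "d = (e / 4) / (c + 1)"
  have "(c + 1) * (q / (c + 1)) = q" for q :: real using c by simp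
  then have d: "(c + 1) * d = e / 4" unfolding d_def .
  have d_pos: "0 < d" using e c by (simp add: d_def)
  have e4: "0 < e / 4" using e by simp
  obtain n N0 where n: "0 < n" and N0: "\<forall>N\<ge>N0. \<forall>\<^sub>F x in at_top.
     \<bar>(LINT y:{x - real N * (1 / real n)<..x}|U. z (x - y)) - I / (1 - \<theta>)\<^sup>2 * g x\<bar> \<le> e / 4 * g x"
    using end_part[OF e4] by blast
  obtain a1 where a1: "\<forall>a\<ge>a1. measure U {a<..} \<le> d"
    using finite_measure_tail_small[OF finite_measure_U sets_U d_pos] by blast
  obtain a2 where a2: "\<forall>a\<ge>a2. \<forall>\<^sub>F x in at_top. GU.far a 1 x \<le> d * g x"
    using one.far_GU_small[OF d_pos] by blast
  obtain a3 where a3: "\<forall>x\<ge>a3. \<bar>z x - c * g x\<bar> \<le> 1 * g x"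
    using eventually_le_of_ratio_tendsto[OF g_pos lim zero_less_one] unfolding eventually_at_top_linorder by blast
  \<comment> \<open>The cutoff a must be a multiple of the mesh 1/n; N \<ge> n m ensures a \<ge> m,
    beyond all three thresholds.\<close>
  define m where "m = nat \<lceil>max (max a1 a2) (max a3 0)\<rceil>"
  define N where "N = max N0 (n * m)"
  define a where "a = real N * (1 / real n)"
  have "max (max a1 a2) (max a3 0) \<le> real m" unfolding m_def by linarith
  also have "\<dots> = real (n * m) * (1 / real n)" using n by simp
  also have "\<dots> \<le> a" unfolding a_def N_def by (intro mult_right_mono) (simp_all del: of_nat_mult)
  finally have a: "a1 \<le> a" "a2 \<le> a" "a3 \<le> a" "0 \<le> a" by auto
  \<comment> \<open>In the middle piece x - y \<ge> a, so z is dominated there by a multiple of unit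
    windows and the far mass of (G, U) applies.\<close>
  have zle: "z x \<le> (c + 1) * g x" if "x \<ge> a" for x
  proof -
    have "\<bar>z x - c * g x\<bar> \<le> 1 * g x" using a3 a(3) that by auto
    then show ?thesis by (simp add: abs_le_iff algebra_simps)
  qed
  have 3: "\<forall>\<^sub>F x in at_top. \<bar>(LINT y:{x - a<..x}|U. z (x - y)) - I / (1 - \<theta>)\<^sup>2 * g x\<bar> \<le> e / 4 * g x"
    using N0 unfolding a_def N_def by simp
  have 1: "\<forall>\<^sub>F x in at_top. \<bar>(LINT y:{0..a}|U. z (x - y)) - c * g x * measure U {0..a}\<bar> \<le> e / 4 * g x"
    by (rule set_integral_near[OF finite_measure_U sets_U z_meas g_long_tailed lim _ _ e4, where a=a]) auto
  have 2: "\<forall>\<^sub>F x in at_top. GU.far a 1 x \<le> d * g x" using a2 a by blast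
  from 1 2 3 g_pos eventually_ge_at_top[of "2 * a"]
  show "\<forall>\<^sub>F x in at_top. \<bar>Z x - (I / (1 - \<theta>)\<^sup>2 + c / (1 - \<theta>)) * g x\<bar> \<le> e * g x"
  proof eventually_elim
    case (elim x)
    let ?M = "{a<..x - a}"
    have int: "set_integrable U S (\<lambda>y. z (x - y))" if "S \<in> sets borel" "S \<subseteq> {0..x}" for S
      by (rule z_integrable[OF finite_measure_U sets_U that(1)])
         (use that(2) in \<open>auto intro: bdd_below_mono\<close>)
    have i1: "set_integrable U {0..a} (\<lambda>y. z (x - y))" and i2: "set_integrable U ?M (\<lambda>y. z (x - y))"
      and i3: "set_integrable U {x - a<..x} (\<lambda>y. z (x - y))"
      and i4: "set_integrable U ({0..a} \<union> ?M) (\<lambda>y. z (x - y))"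
      using a elim(5) by (auto intro!: int)
    have *: "{0..x} = ({0..a} \<union> ?M) \<union> {x - a<..x}" using elim(5) a by auto
    have "Z x = (LINT y:{0..a} \<union> ?M|U. z (x - y)) + (LINT y:{x - a<..x}|U. z (x - y))"
      unfolding Z_integral[of x] * by (rule set_integral_Un[OF _ i4 i3]) (use elim(5) a in auto)
    also have "(LINT y:{0..a} \<union> ?M|U. z (x - y)) = (LINT y:{0..a}|U. z (x - y)) + (LINT y:?M|U. z (x - y))"
      by (rule set_integral_Un[OF _ i1 i2]) auto
    finally have Z: "Z x = (LINT y:{0..a}|U. z (x - y)) + (LINT y:?M|U. z (x - y)) + (LINT y:{x - a<..x}|U. z (x - y))" .
    interpret UG: finite_borel_pair U G by (rule finite_borel_pair_commute) (rule GU.finite_borel_pair_axioms)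
    have "(LINT y:?M|U. z (x - y)) \<le> (LINT y:?M|U. (c + 1) * g (x - y))"
    proof (rule set_integral_mono[OF i2])
      show "set_integrable U ?M (\<lambda>y. (c + 1) * g (x - y))"
        using UG.window_integrable[of ?M G x 1] finite_measure_G sets_G by (intro set_integrable_mult_right) auto
    qed (rule zle, simp)
    also have "\<dots> = (c + 1) * (LINT y:?M|U. g (x - y))" by (rule set_integral_mult_right)
    also have "(LINT y:?M|U. g (x - y)) = measure (G \<Otimes>\<^sub>M U) {(y, w). w \<in> ?M \<and> x < y + w \<and> y + w \<le> x + 1}"
      by (rule GU.measure_strip_snd[symmetric]) simp
    \<comment> \<open>From w \<le> x - a and y + w > x follows y > a.\<close>
    also have "\<dots> \<le> GU.far a 1 x"
      unfolding GU.far_def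
      by (rule GU.P.finite_measure_mono) (use GU.strip_set[of "{a<..}" "{a<..}" x 1] in auto)
    also have "GU.far a 1 x \<le> d * g x" by (rule elim(2))
    finally have M: "(LINT y:?M|U. z (x - y)) \<le> (c + 1) * (d * g x)" using c by (simp add: mult_left_mono)
    \<comment> \<open>The three pieces p, q, r and the tail deficit t are abstracted to atoms for
      \<open>linarith\<close>.\<close>
    have sum_le: "\<bar>p + q + r - (B + A)\<bar> \<le> E"
      if "\<bar>p - (A - t)\<bar> \<le> E / 4" "0 \<le> t" "t \<le> E / 4" "0 \<le> q" "q \<le> E / 4" "\<bar>r - B\<bar> \<le> E / 4"
      for p q r A B t E :: real using that by linarith
    have "(c + 1) * (d * g x) = e / 4 * g x" using d by (simp add: mult.assoc[symmetric])
    with M have M: "(LINT y:?M|U. z (x - y)) \<le> e * g x / 4" by simp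
    have nonneg: "0 \<le> (LINT y:?M|U. z (x - y))"
      unfolding set_lebesgue_integral_def
      by (intro Bochner_Integration.integral_nonneg) (use z_nonneg a in \<open>auto simp: indicator_def\<close>)
    have split: "c * g x * measure U {0..a} = c / (1 - \<theta>) * g x - c * g x * measure U {a<..}"
      by (simp add: measure_U_split[OF a(4)] algebra_simps)
    have tail: "c * g x * measure U {a<..} \<le> e / 4 * g x"
    proof -
      have "c * measure U {a<..} \<le> (c + 1) * d" using a1 a c d_pos by (intro mult_mono) auto
      then have "c * measure U {a<..} * g x \<le> e / 4 * g x" using d elim(4) by (intro mult_right_mono) auto
      then show ?thesis by (simp add: ac_simps)
    qed
    show ?case
      unfolding Z distrib_right
    proof (rule sum_le)
      show "\<bar>(LINT y:{0..a}|U. z (x - y)) - (c / (1 - \<theta>) * g x - c * g x * measure U {a<..})\<bar> \<le> e * g x / 4"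
        using elim(1) unfolding split by simp
    qed (use c M nonneg tail elim(3) in simp_all)
  qed
qed

end

section \<open>From the hypotheses on normalised objects to the working assumptions, and the final
  assembly\<close>

lemma (in defective_renewal) subexponential_renewalI:
  assumes T: "0 < T" and S: "subexp_Delta T (scale_measure (ennreal (1 / \<theta>)) G)"
  shows "subexponential_renewal G \<theta> T"
proof -
  let ?F = "scale_measure (ennreal (1 / \<theta>)) G"
  have F: "measure ?F A = measure G A / \<theta>" for A
    using \<theta>_pos by (simp add: measure_def enn2real_mult)
  have lt: "long_tailed_Delta T ?F"
    and conv: "((\<lambda>x. measure (convolution ?F ?F) {x<..x+T} / measure ?F {x<..x+T}) \<longlongrightarrow> 2) at_top"
    and fin: "finite_measure ?F"
    using S by (auto simp: subexp_Delta_def prob_space.finite_measure)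
  \<comment> \<open>Scaling acts on both factors of the convolution, hence the square.\<close>
  have FF: "measure (convolution ?F ?F) {x<..x+T} = measure (convolution G G) {x<..x+T} / \<theta>\<^sup>2" for x
  proof -
    have [measurable_cong]: "sets G = sets borel" by (rule sets_G)
    have m: "(\<lambda>y. emeasure G {w. w + y \<in> {x<..x+T}}) \<in> borel_measurable G"
    proof -
      have "{w. w + y \<in> {x<..x+T}} = {x - y<..x - y + T}" for y by auto
      then have "(\<lambda>y. emeasure G {w. w + y \<in> {x<..x+T}}) = (\<lambda>y. ennreal (measure G {x - y<..x - y + T}))"
        by (simp add: G.emeasure_eq_measure)
      moreover have "(\<lambda>y. measure G {x - y<..x - y + T}) \<in> borel_measurable G"
        by (rule measurable_compose[OF _ measurable_G_window]) simp
      ultimately show ?thesis by simp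
    qed
    have "emeasure (convolution ?F ?F) {x<..x+T} = (\<integral>\<^sup>+y. emeasure ?F {w. w + y \<in> {x<..x+T}} \<partial>?F)"
      by (rule convolution_emeasure[OF _ fin fin]) (simp_all add: sets_G space_scale_measure space_G)
    also have "\<dots> = ennreal (1 / \<theta>) * (ennreal (1 / \<theta>) * (\<integral>\<^sup>+y. emeasure G {w. w + y \<in> {x<..x+T}} \<partial>G))"
      using m by (simp add: nn_integral_scale_measure nn_integral_cmult)
    also have "(\<integral>\<^sup>+y. emeasure G {w. w + y \<in> {x<..x+T}} \<partial>G) = emeasure (convolution G G) {x<..x+T}"
      by (rule convolution_emeasure[OF _ finite_measure_G finite_measure_G, symmetric]) (simp_all add: sets_G space_G)
    finally show ?thesis using \<theta>_pos by (simp add: measure_def enn2real_mult power2_eq_square)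
  qed
  show ?thesis
  proof unfold_locales
    show "long_tailed_fun (\<lambda>x. measure G {x<..x+T})"
      using lt \<theta>_pos unfolding long_tailed_Delta_def long_tailed_fun_def F by (simp add: zero_less_divide_iff)
    have "((\<lambda>x. \<theta> * (measure (convolution ?F ?F) {x<..x+T} / measure ?F {x<..x+T})) \<longlongrightarrow> \<theta> * 2) at_top"
      by (intro tendsto_mult tendsto_const conv)
    moreover have "\<theta> * (measure (convolution ?F ?F) {x<..x+T} / measure ?F {x<..x+T})
       = measure (convolution G G) {x<..x+T} / measure G {x<..x+T}" for x
      using \<theta>_pos unfolding F FF by (simp add: power2_eq_square)
    ultimately show "((\<lambda>x. measure (convolution G G) {x<..x+T} / measure G {x<..x+T}) \<longlongrightarrow> 2 * \<theta>) at_top"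
      by (simp add: mult.commute)
  qed (rule T)
qed

text \<open>From the convolution condition on z/I an upper bound of order z on the middle integral
  is extracted. Smallness comes later, from the windows of G being o(z).\<close>

lemma (in renewal_equation) density_dominatedI:
  assumes I: "0 < I" and S: "subexp_density (\<lambda>y. z y / I)"
    and g: "((\<lambda>x. measure G {x<..x+1} / z x) \<longlongrightarrow> 0) at_top"
  shows "\<exists>xh C. density_dominated G \<theta> z xh C"
proof -
  obtain xh where xh: "0 \<le> xh" and pos: "\<forall>\<^sub>F x in at_top. z x / I > 0"
    and lt: "\<forall>\<epsilon>>0. \<forall>\<^sub>F x in at_top. \<forall>t\<in>{0..1}. \<bar>(z (x + t) / I) / (z x / I) - 1\<bar> < \<epsilon>"
    and conv: "(\<lambda>x. 2 * (LINT y:{0..xh}|lborel. z (x - y) / I * (z y / I))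
              + (LINT y:{xh..x-xh}|lborel. z (x - y) / I * (z y / I))) \<sim>[at_top] (\<lambda>x. 2 * (z x / I))"
    using S unfolding subexp_density_def by blast
  have pos: "\<forall>\<^sub>F x in at_top. 0 < z x" using pos I by (simp add: zero_less_divide_iff)
  have "long_tailed_fun z" using pos lt I unfolding long_tailed_fun_def by simp
  moreover have "\<forall>\<^sub>F x in at_top. (LINT y:{xh..x - xh}|lborel. z (x - y) * z y) \<le> 4 * I * z x"
  proof -
    let ?f = "\<lambda>x. 2 * (LINT y:{0..xh}|lborel. z (x - y) / I * (z y / I))
              + (LINT y:{xh..x-xh}|lborel. z (x - y) / I * (z y / I))"
    \<comment> \<open>The relation \<open>asymp_equiv\<close> counts 0/0 as 1; positivity of z
      removes that case. Any bound above the limit 1 would do, and 2 leads to the constant 4 I after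
      undoing the two normalisations by I.\<close>
    have "\<forall>\<^sub>F x in at_top. (if ?f x = 0 \<and> 2 * (z x / I) = 0 then 1 else ?f x / (2 * (z x / I))) < 2"
      using conv unfolding asymp_equiv_def by (rule order_tendstoD) simp
    with pos eventually_ge_at_top[of xh] show ?thesis
    proof eventually_elim
      case (elim x)
      have "?f x / (2 * (z x / I)) < 2" using elim I by simp
      then have "?f x < 4 * (z x / I)" using elim(1) I by (subst (asm) pos_divide_less_eq) auto
      moreover have "0 \<le> (LINT y:{0..xh}|lborel. z (x - y) / I * (z y / I))"
        unfolding set_lebesgue_integral_def
        by (intro Bochner_Integration.integral_nonneg) (use z_nonneg elim(2) I in \<open>auto simp: indicator_def\<close>)
      moreover have "(LINT y:{xh..x-xh}|lborel. z (x - y) / I * (z y / I)) = (LINT y:{xh..x-xh}|lborel. z (x - y) * z y) / (I * I)"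
        by simp
      ultimately have "(LINT y:{xh..x-xh}|lborel. z (x - y) * z y) / (I * I) < 4 * (z x / I)" by linarith
      then show ?case using I by (simp add: field_simps)
    qed
  qed
  ultimately have "density_dominated G \<theta> z xh (4 * I)"
    by unfold_locales (use xh I g in auto)
  then show ?thesis by blast
qed

theorem theorem5:
  fixes G :: "real measure" and \<theta> :: real and z :: "real \<Rightarrow> real"
  assumes G_sets: "sets G = sets borel"
    and G_supp: "emeasure G {..0} = 0"
    and G_mass: "emeasure G UNIV = ennreal \<theta>"
    and \<theta>_pos: "0 < \<theta>" and \<theta>_lt1: "\<theta> < 1"
    and z_meas: "z \<in> borel_measurable borel"
    and z_nonneg: "\<And>x. x \<ge> 0 \<Longrightarrow> z x \<ge> 0"
    and z_lb: "locally_bounded z"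
  defines "g \<equiv> (\<lambda>x. measure G {x<..x+1})"
    and "I \<equiv> enn2real (\<integral>\<^sup>+ y. indicator {0..} y * ennreal (z y) \<partial>lborel)"
    and "Z \<equiv> renewal_sol G z"
  shows
    "((\<forall>T>0. subexp_Delta T (scale_measure (ennreal (1 / \<theta>)) G)) \<and> dRi z
         \<and> ((\<lambda>x. z x / g x) \<longlongrightarrow> 0) at_top
       \<longrightarrow> ((\<lambda>x. Z x / g x) \<longlongrightarrow> I / (1 - \<theta>)\<^sup>2) at_top)
   \<and> (\<forall>c. 0 < c \<and> (\<forall>T>0. subexp_Delta T (scale_measure (ennreal (1 / \<theta>)) G)) \<and> dRi z
         \<and> ((\<lambda>x. z x / g x) \<longlongrightarrow> c) at_top
       \<longrightarrow> ((\<lambda>x. Z x / g x) \<longlongrightarrow> I / (1 - \<theta>)\<^sup>2 + c / (1 - \<theta>)) at_top)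
   \<and> (0 < (\<integral>\<^sup>+ y. indicator {0..} y * ennreal (z y) \<partial>lborel)
         \<and> (\<integral>\<^sup>+ y. indicator {0..} y * ennreal (z y) \<partial>lborel) < \<infinity>
         \<and> subexp_density (\<lambda>y. z y / I)
         \<and> ((\<lambda>x. g x / z x) \<longlongrightarrow> 0) at_top
       \<longrightarrow> Z \<sim>[at_top] (\<lambda>x. z x / (1 - \<theta>)))"
proof -
  have R: "renewal_equation G \<theta> z"
    using assms(1-8) by unfold_locales
  interpret renewal_equation G \<theta> z by (rule R)
  have 12: "((\<lambda>x. Z x / g x) \<longlongrightarrow> I / (1 - \<theta>)\<^sup>2 + c / (1 - \<theta>)) at_top"
    if "0 \<le> c" and S: "\<forall>T>0. subexp_Delta T (scale_measure (ennreal (1 / \<theta>)) G)" and "dRi z"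
      and lim: "((\<lambda>x. z x / g x) \<longlongrightarrow> c) at_top" for c
  proof -
    have "subexponential_renewal_equation G \<theta> z"
      using subexponential_renewalI S \<open>dRi z\<close>
      by (intro subexponential_renewal_equation.intro R subexponential_renewal_equation_axioms.intro) auto
    then interpret S: subexponential_renewal_equation G \<theta> z .
    show ?thesis
      using S.Z_limit[OF \<open>0 \<le> c\<close>] lim unfolding S.I_def Z_def g_def I_def by simp
  qed
  have 3: "Z \<sim>[at_top] (\<lambda>x. z x / (1 - \<theta>))"
    if pos: "0 < (\<integral>\<^sup>+ y. indicator {0..} y * ennreal (z y) \<partial>lborel)"
         "(\<integral>\<^sup>+ y. indicator {0..} y * ennreal (z y) \<partial>lborel) < \<infinity>"
      and S: "subexp_density (\<lambda>y. z y / I)" and lim: "((\<lambda>x. g x / z x) \<longlongrightarrow> 0) at_top"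
  proof -
    \<comment> \<open>Finiteness matters here: an infinite integral would become 0 under
      \<open>enn2real\<close>.\<close>
    have "0 < I" unfolding I_def using pos by (simp add: enn2real_positive_iff)
    from density_dominatedI[OF this S] lim obtain xh C where "density_dominated G \<theta> z xh C"
      by (auto simp: g_def)
    then interpret D: density_dominated G \<theta> z xh C .
    have "((\<lambda>x. (1 - \<theta>) * (Z x / z x)) \<longlongrightarrow> (1 - \<theta>) * (1 / (1 - \<theta>))) at_top"
      unfolding Z_def by (intro tendsto_mult tendsto_const D.Z_limit)
    then have "((\<lambda>x. Z x / (z x / (1 - \<theta>))) \<longlongrightarrow> 1) at_top"
      using \<theta>_lt1 by (simp add: ac_simps)
    then show ?thesis by (rule asymp_equivI')
  qed
  \<comment> \<open>Part (i) is the case c = 0, where the second summand vanishes.\<close>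
  show ?thesis using 12[of 0] 12 3 by (auto simp del: times_divide_eq_left)
qed

end
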